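(* Let $(\mathfrak g=\mathfrak a\oplus\mathfrak b,B,\omega)$ be a special odd (resp. even)-symplectic even (resp. odd)-Manin superalgebra and let $\Delta$ be the unique odd invertible skew-supersymmetric superderivation of $\mathfrak g$ such that $\omega(X,Y)=B(\Delta(X),Y)$ for all $X,Y\in\mathfrak g$, $\Delta(\mathfrak a)\subseteq\mathfrak a$ and $\Delta(\mathfrak b)\subseteq\mathfrak b$. If either $\mathfrak z(\mathfrak g)\cap\mathfrak a\ne\{0\}$ or $\mathfrak z(\mathfrak g)\cap\mathfrak b\neq\{0\}$, then $\mathfrak g$ is a generalized double extension (resp. generalized odd double extension) of a special odd (resp. even)-symplectic even (resp. odd)-Manin superalgebra $(\mathfrak h=\widetilde{\mathfrak a}\oplus\widetilde{\mathfrak b},B_{\mathfrak h},\omega_{\mathfrak h})$ by the two-dimensional abelian Lie superalgebra.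
   Context: All Lie superalgebras are finite dimensional over an algebraically closed field $\mathbb K$ of characteristic zero; $|x|\in\mathbb Z_2$ is the degree of a homogeneous $X$; $\mathfrak z(\mathfrak g)$ is the center. A bilinear form $\theta$ is even if $\theta(\mathfrak g_\alpha,\mathfrak g_\beta)=\{0\}$ for $\alpha\ne\beta$, odd if $\theta(\mathfrak g_\alpha,\mathfrak g_\alpha)=\{0\}$ for all $\alpha$. An even (resp. odd)-quadratic structure $B$ is an even (resp. odd), supersymmetric ($B(X,Y)=(-1)^{|x||y|}B(Y,X)$), invariant ($B([X,Y],Z)=B(X,[Y,Z])$), non-degenerate bilinear form. An even (resp. odd)-symplectic structure $\omega$ is an even (resp. odd), skew-supersymmetric ($\omega(X,Y)=-(-1)^{|x||y|}\omega(Y,X)$), non-degenerate form with $(-1)^{|z||x|}\omega(X,[Y,Z])+(-1)^{|x||y|}\omega(Y,[Z,X])+(-1)^{|y||z|}\omega(Z,[X,Y])=0$. A special odd (resp. even)-symplectic even (resp. odd)-Manin superalgebra is $(\mathfrak g=\mathfrak a\oplus\mathfrak b,B,\omega)$, a vector space direct sum of Lie sub-superalgebras, with $B$ an even (resp. odd)-quadratic structure, $\omega$ an odd (resp. even)-symplectic structure, and $B$, $\omega$ both vanishing on $\mathfrak a\times\mathfrak a$ and on $\mathfrak b\times\mathfrak b$. A superderivation $\Delta$ of degree $d$ satisfies $\Delta(\mathfrak g_\alpha)\subseteq \mathfrak g_{\alpha+d}$ and $\Delta[X,Y]=[\Delta(X),Y]+(-1)^{d|x|}[X,\Delta(Y)]$;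 it is skew-supersymmetric for $B$ if $B(\Delta(X),Y)=-(-1)^{d|x|}B(X,\Delta(Y))$. Brackets of endomorphisms are supercommutators. Extension data: $(\mathfrak h,B,\omega)$ with $B$ even and $\omega$ odd (resp. $B$ odd and $\omega$ even), $\delta$ the odd invertible skew-supersymmetric superderivation with $\omega=B(\delta\cdot,\cdot)$; $D$ (even) and $\bar D$ (odd) skew-supersymmetric superderivations of $(\mathfrak h,B)$, $x_0,c_0\in\mathfrak h_{\bar0}$, $x_1,c_1\in\mathfrak h_{\bar1}$, $k,\alpha\in\mathbb K$, $\lambda\in\mathbb K\setminus\{0\}$; $\mathfrak t=\mathbb Ke_0^*\oplus\mathbb Ke_1^*\oplus\mathfrak h\oplus\mathbb Ke_0\oplus\mathbb Ke_1$ with $e_0,e_0^*$ even, $e_1,e_1^*$ odd, $e_0^*,e_1^*$ central, $[e_0,e_0]=0$. In both cases one requires $\bar D^2=\frac12\mathrm{ad}(x_0)$, $\bar D(x_0)=0$, $[D,\bar D]=\mathrm{ad}(x_1)$, $D(x_0)=2\bar D(x_1)$. Generalized double extension ($B$ even, $\omega$ odd): require also $B(x_0,x_0)=0$, $[\delta,D]-\lambda\bar D=\mathrm{ad}(c_1)$, $[\delta,\bar D]+\lambda D=\mathrm{ad}(c_0)$, $\delta(x_0)=-2\lambda x_1-2\bar D(c_0)$, $\delta(x_1)=\lambda x_0+D(c_0)+\bar D(c_1)$, $\lambda k=B(c_0,x_0)$. Bracket: $[X,Y]=[X,Y]_{\mathfrak h}-B(\bar D(X),Y)e_1^*+B(D(X),Y)e_0^*$,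 $[e_0,X]=D(X)+B(x_1,X)e_1^*$, $[e_1,X]=\bar D(X)-B(x_0,X)e_1^*+B(x_1,X)e_0^*$, $[e_1,e_1]=ke_0^*+x_0$, $[e_0,e_1]=ke_1^*+x_1$. Form: $\gamma|_{\mathfrak h\times\mathfrak h}=B$, $\gamma(e_0^*,e_0)=1=\gamma(e_1^*,e_1)$, supersymmetric, zero elsewhere. $\Delta_{\mathfrak t}(e_0^* )=\lambda e_1^*$, $\Delta_{\mathfrak t}(e_1^* )=\lambda e_0^*$, $\Delta_{\mathfrak t}(e_0)=\alpha e_1^*+c_1+\lambda e_1$, $\Delta_{\mathfrak t}(e_1)=-\alpha e_0^*+c_0-\lambda e_0$, $\Delta_{\mathfrak t}(X)=-B(c_1,X)e_0^*+\delta(X)-B(c_0,X)e_1^*$. Generalized odd double extension ($B$ odd, $\omega$ even): require also $B(x_0,x_1)=0$, $\mathrm{ad}(c_0)=[\delta,\bar D]-\lambda D$, $\mathrm{ad}(c_1)=[\delta,D]+\lambda\bar D$, $\delta(x_0)=-2\bar D(c_0)+2\lambda x_1$, $\delta(x_1)=D(c_0)+\bar D(c_1)-\lambda x_0$, $\lambda k=B(c_1,x_0)-2B(x_1,c_0)$. Bracket: $[X,Y]=[X,Y]_{\mathfrak h}+B(\bar D(X),Y)e_0^*+B(D(X),Y)e_1^*$, $[e_0,X]=D(X)-B(x_1,X)e_0^*$, $[e_1,X]=\bar D(X)+B(x_0,X)e_0^*+B(x_1,X)e_1^*$, $[e_0,e_1]=x_1$, $[e_1,e_1]=ke_0^*+x_0$.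 Form: $\gamma|_{\mathfrak h\times\mathfrak h}=B$, $\gamma(e_0^*,e_1)=1=\gamma(e_1^*,e_0)$, supersymmetric, zero elsewhere. $\Delta_{\mathfrak t}(e_0^* )=\lambda e_1^*$, $\Delta_{\mathfrak t}(e_1^* )=\lambda e_0^*$, $\Delta_{\mathfrak t}(e_0)=c_1-\lambda e_1$, $\Delta_{\mathfrak t}(e_1)=\alpha e_0^*+c_0+\lambda e_0$, $\Delta_{\mathfrak t}(X)=B(c_0,X)e_0^*+\delta(X)-B(c_1,X)e_1^*$. In each case the extension of $(\mathfrak h,B,\omega)$ by the two-dimensional abelian Lie superalgebra is $(\mathfrak t,\gamma,\Omega)$ with $\Omega(X,Y)=\gamma(\Delta_{\mathfrak t}(X),Y)$; "is a generalized (odd) double extension" means up to isomorphism preserving both forms. *)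

theory Defs
  imports
    "HOL-Computational_Algebra.Polynomial"
    "HOL-Library.Z2"
    "HOL-Library.Product_Plus"
begin

text \<open>
  Vector spaces are subspaces (in the sense of \<^term>\<open>module.subspace\<close>) of an ambient type that
  carries a scalar multiplication \<open>s\<close>; degrees are elements of the type \<^typ>\<open>bit\<close>, i.e. of the
  integers modulo 2. Maps and forms are total functions on the ambient type, but only their values
  on the carriers matter. Since carriers may be proper subspaces, superalgebras of smaller dimension
  can be realized in the same ambient type.
\<close>

definition ksign :: "bit \<Rightarrow> 'k::ring_1"  \<comment> \<open>\<open>(-1)\<^sup>d\<close>\<close>
  where "ksign d = (if d = 0 then 1 else - 1)"

definition linear_on ::
  "('k \<Rightarrow> 'u \<Rightarrow> 'u) \<Rightarrow> ('k \<Rightarrow> 'w \<Rightarrow> 'w) \<Rightarrow> 'u::ab_group_add set \<Rightarrow> ('u \<Rightarrow> 'w::ab_group_add) \<Rightarrow> bool"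
  where "linear_on s s' V f \<longleftrightarrow>
    (\<forall>x\<in>V. \<forall>y\<in>V. f (x + y) = f x + f y) \<and> (\<forall>c. \<forall>x\<in>V. f (s c x) = s' c (f x))"

definition bilinear_on ::
  "('k \<Rightarrow> 'u \<Rightarrow> 'u) \<Rightarrow> ('k \<Rightarrow> 'w \<Rightarrow> 'w) \<Rightarrow> 'u::ab_group_add set \<Rightarrow> ('u \<Rightarrow> 'u \<Rightarrow> 'w::ab_group_add) \<Rightarrow> bool"
  where "bilinear_on s s' V f \<longleftrightarrow>
    (\<forall>x\<in>V. linear_on s s' V (f x)) \<and> (\<forall>y\<in>V. linear_on s s' V (\<lambda>x. f x y))"


section \<open>Lie superalgebras\<close>

record 'v superalgebra =
  part :: "bit \<Rightarrow> 'v set"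
  brk :: "'v \<Rightarrow> 'v \<Rightarrow> 'v"

definition scarrier :: "('v::ab_group_add) superalgebra \<Rightarrow> 'v set"
  where "scarrier G = {x + y | x y. x \<in> part G 0 \<and> y \<in> part G 1}"

definition lie_superalgebra ::
  "('k::field \<Rightarrow> 'v \<Rightarrow> 'v) \<Rightarrow> ('v::ab_group_add) superalgebra \<Rightarrow> bool"
  where "lie_superalgebra s G \<longleftrightarrow>
    (\<forall>d. module.subspace s (part G d)) \<and> part G 0 \<inter> part G 1 = {0} \<and>
    (\<exists>S. finite S \<and> module.span s S = scarrier G) \<and>
    bilinear_on s s (scarrier G) (brk G) \<and>
    (\<forall>a b. \<forall>x\<in>part G a. \<forall>y\<in>part G b. brk G x y \<in> part G (a + b)) \<and>
    (\<forall>a b. \<forall>x\<in>part G a. \<forall>y\<in>part G b. brk G x y = - s (ksign (a * b)) (brk G y x)) \<and>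
    (\<forall>a b c. \<forall>x\<in>part G a. \<forall>y\<in>part G b. \<forall>z\<in>part G c.
       brk G x (brk G y z) = brk G (brk G x y) z + s (ksign (a * b)) (brk G y (brk G x z)))"

definition lie_subsuperalgebra ::
  "('k::field \<Rightarrow> 'v \<Rightarrow> 'v) \<Rightarrow> ('v::ab_group_add) superalgebra \<Rightarrow> 'v set \<Rightarrow> bool"
  where "lie_subsuperalgebra s G A \<longleftrightarrow>
    module.subspace s A \<and>
    A = {x + y | x y. x \<in> A \<inter> part G 0 \<and> y \<in> A \<inter> part G 1} \<and>
    (\<forall>x\<in>A. \<forall>y\<in>A. brk G x y \<in> A)"

definition scenter :: "('v::ab_group_add) superalgebra \<Rightarrow> 'v set"
  where "scenter G = {x \<in> scarrier G. \<forall>y\<in>scarrier G. brk G x y = 0}"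


section \<open>Quadratic and symplectic structures\<close>

text \<open>For \<open>p = 0\<close> this is an even form, for \<open>p = 1\<close> an odd form.\<close>

definition form_parity ::
  "('v::ab_group_add) superalgebra \<Rightarrow> bit \<Rightarrow> ('v \<Rightarrow> 'v \<Rightarrow> 'k::field) \<Rightarrow> bool"
  where "form_parity G p \<theta> \<longleftrightarrow>
    (\<forall>a b. a + b \<noteq> p \<longrightarrow> (\<forall>x\<in>part G a. \<forall>y\<in>part G b. \<theta> x y = 0))"

definition nondegenerate ::
  "('v::ab_group_add) superalgebra \<Rightarrow> ('v \<Rightarrow> 'v \<Rightarrow> 'k::field) \<Rightarrow> bool"
  where "nondegenerate G \<theta> \<longleftrightarrow>
    (\<forall>x\<in>scarrier G. (\<forall>y\<in>scarrier G. \<theta> x y = 0) \<longrightarrow> x = 0)"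

definition quadratic ::
  "('k::field \<Rightarrow> 'v \<Rightarrow> 'v) \<Rightarrow> bit \<Rightarrow> ('v::ab_group_add) superalgebra \<Rightarrow> ('v \<Rightarrow> 'v \<Rightarrow> 'k) \<Rightarrow> bool"
  where "quadratic s p G B \<longleftrightarrow>
    bilinear_on s (*) (scarrier G) B \<and> form_parity G p B \<and>
    (\<forall>a b. \<forall>x\<in>part G a. \<forall>y\<in>part G b. B x y = ksign (a * b) * B y x) \<and>
    (\<forall>x\<in>scarrier G. \<forall>y\<in>scarrier G. \<forall>z\<in>scarrier G. B (brk G x y) z = B x (brk G y z)) \<and>
    nondegenerate G B"

definition symplectic ::
  "('k::field \<Rightarrow> 'v \<Rightarrow> 'v) \<Rightarrow> bit \<Rightarrow> ('v::ab_group_add) superalgebra \<Rightarrow> ('v \<Rightarrow> 'v \<Rightarrow> 'k) \<Rightarrow> bool"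
  where "symplectic s p G \<omega> \<longleftrightarrow>
    bilinear_on s (*) (scarrier G) \<omega> \<and> form_parity G p \<omega> \<and>
    (\<forall>a b. \<forall>x\<in>part G a. \<forall>y\<in>part G b. \<omega> x y = - ksign (a * b) * \<omega> y x) \<and>
    nondegenerate G \<omega> \<and>
    (\<forall>a b c. \<forall>x\<in>part G a. \<forall>y\<in>part G b. \<forall>z\<in>part G c.
       ksign (c * a) * \<omega> x (brk G y z) + ksign (a * b) * \<omega> y (brk G z x)
         + ksign (b * c) * \<omega> z (brk G x y) = 0)"

text \<open>
  For \<open>p = 0\<close>: special odd-symplectic even-Manin superalgebra; for \<open>p = 1\<close>: special
  even-symplectic odd-Manin superalgebra. The form \<open>\<omega>\<close> has the parity opposite to that of \<open>B\<close>.
\<close>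

definition special_manin ::
  "('k::field \<Rightarrow> 'v \<Rightarrow> 'v) \<Rightarrow> bit \<Rightarrow> ('v::ab_group_add) superalgebra \<Rightarrow> 'v set \<Rightarrow> 'v set \<Rightarrow>
    ('v \<Rightarrow> 'v \<Rightarrow> 'k) \<Rightarrow> ('v \<Rightarrow> 'v \<Rightarrow> 'k) \<Rightarrow> bool"
  where "special_manin s p G \<aa> \<bb> B \<omega> \<longleftrightarrow>
    lie_superalgebra s G \<and> lie_subsuperalgebra s G \<aa> \<and> lie_subsuperalgebra s G \<bb> \<and>
    \<aa> \<inter> \<bb> = {0} \<and> scarrier G = {x + y | x y. x \<in> \<aa> \<and> y \<in> \<bb>} \<and>
    quadratic s p G B \<and> symplectic s (p + 1) G \<omega> \<and>
    (\<forall>x\<in>\<aa>. \<forall>y\<in>\<aa>. B x y = 0 \<and> \<omega> x y = 0) \<and> (\<forall>x\<in>\<bb>. \<forall>y\<in>\<bb>. B x y = 0 \<and> \<omega> x y = 0)"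


section \<open>Superderivations\<close>

definition superderivation ::
  "('k::field \<Rightarrow> 'v \<Rightarrow> 'v) \<Rightarrow> bit \<Rightarrow> ('v::ab_group_add) superalgebra \<Rightarrow> ('v \<Rightarrow> 'v) \<Rightarrow> bool"
  where "superderivation s d G f \<longleftrightarrow>
    linear_on s s (scarrier G) f \<and> (\<forall>a. f ` part G a \<subseteq> part G (a + d)) \<and>
    (\<forall>a. \<forall>x\<in>part G a. \<forall>y\<in>scarrier G.
       f (brk G x y) = brk G (f x) y + s (ksign (d * a)) (brk G x (f y)))"

definition skew_supersymmetric ::
  "bit \<Rightarrow> ('v::ab_group_add) superalgebra \<Rightarrow> ('v \<Rightarrow> 'v \<Rightarrow> 'k::field) \<Rightarrow> ('v \<Rightarrow> 'v) \<Rightarrow> bool"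
  where "skew_supersymmetric d G B f \<longleftrightarrow>
    (\<forall>a. \<forall>x\<in>part G a. \<forall>y\<in>scarrier G. B (f x) y = - ksign (d * a) * B x (f y))"

text \<open>\<open>\<Delta>\<close> is an odd invertible skew-supersymmetric superderivation with \<open>\<omega> = B(\<Delta>\<cdot>, \<cdot>)\<close>; when \<open>B\<close> is
  non-degenerate, these conditions determine its values on the carrier.\<close>

definition symplectic_derivation ::
  "('k::field \<Rightarrow> 'v \<Rightarrow> 'v) \<Rightarrow> ('v::ab_group_add) superalgebra \<Rightarrow>
    ('v \<Rightarrow> 'v \<Rightarrow> 'k) \<Rightarrow> ('v \<Rightarrow> 'v \<Rightarrow> 'k) \<Rightarrow> ('v \<Rightarrow> 'v) \<Rightarrow> bool"
  where "symplectic_derivation s G B \<omega> \<Delta> \<longleftrightarrow>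
    superderivation s 1 G \<Delta> \<and> skew_supersymmetric 1 G B \<Delta> \<and>
    bij_betw \<Delta> (scarrier G) (scarrier G) \<and>
    (\<forall>x\<in>scarrier G. \<forall>y\<in>scarrier G. \<omega> x y = B (\<Delta> x) y)"

definition supercomm ::
  "('k::field \<Rightarrow> 'v \<Rightarrow> 'v) \<Rightarrow> bit \<Rightarrow> bit \<Rightarrow> ('v::ab_group_add \<Rightarrow> 'v) \<Rightarrow> ('v \<Rightarrow> 'v) \<Rightarrow> 'v \<Rightarrow> 'v"
  where "supercomm s d d' f g x = f (g x) - s (ksign (d * d')) (g (f x))"

definition parity_inv :: "('v::ab_group_add) superalgebra \<Rightarrow> 'v \<Rightarrow> 'v"
  where "parity_inv H x = (THE y. \<exists>u\<in>part H 0. \<exists>v\<in>part H 1. x = u + v \<and> y = u - v)"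


section \<open>Extension data\<close>

record ('k, 'v) ext_data =
  ext_delta :: "'v \<Rightarrow> 'v"
  ext_D :: "'v \<Rightarrow> 'v"
  ext_Dbar :: "'v \<Rightarrow> 'v"
  ext_x0 :: 'v
  ext_x1 :: 'v
  ext_c0 :: 'v
  ext_c1 :: 'v
  ext_k :: 'k
  ext_al :: 'k
  ext_lam :: 'k

definition ext_data_common ::
  "('k::field \<Rightarrow> 'v \<Rightarrow> 'v) \<Rightarrow> bit \<Rightarrow> ('v::ab_group_add) superalgebra \<Rightarrow>
    ('v \<Rightarrow> 'v \<Rightarrow> 'k) \<Rightarrow> ('v \<Rightarrow> 'v \<Rightarrow> 'k) \<Rightarrow> ('k, 'v) ext_data \<Rightarrow> bool"
  where "ext_data_common s p H B \<omega> E \<longleftrightarrow>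
    (let D = ext_D E; Db = ext_Dbar E; x0 = ext_x0 E; x1 = ext_x1 E in
      lie_superalgebra s H \<and> quadratic s p H B \<and> symplectic s (p + 1) H \<omega> \<and>
      symplectic_derivation s H B \<omega> (ext_delta E) \<and>
      superderivation s 0 H D \<and> skew_supersymmetric 0 H B D \<and>
      superderivation s 1 H Db \<and> skew_supersymmetric 1 H B Db \<and>
      x0 \<in> part H 0 \<and> x1 \<in> part H 1 \<and> ext_c0 E \<in> part H 0 \<and> ext_c1 E \<in> part H 1 \<and>
      ext_lam E \<noteq> 0 \<and>
      (\<forall>X\<in>scarrier H. Db (Db X) = s (1 / 2) (brk H x0 X)) \<and>
      Db x0 = 0 \<and>
      (\<forall>X\<in>scarrier H. supercomm s 0 1 D Db X = brk H x1 X) \<and>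
      D x0 = s 2 (Db x1))"

definition even_ext_data ::
  "('k::field \<Rightarrow> 'v \<Rightarrow> 'v) \<Rightarrow> ('v::ab_group_add) superalgebra \<Rightarrow>
    ('v \<Rightarrow> 'v \<Rightarrow> 'k) \<Rightarrow> ('v \<Rightarrow> 'v \<Rightarrow> 'k) \<Rightarrow> ('k, 'v) ext_data \<Rightarrow> bool"
  where "even_ext_data s H B \<omega> E \<longleftrightarrow>
    ext_data_common s 0 H B \<omega> E \<and>
    (let \<delta> = ext_delta E; D = ext_D E; Db = ext_Dbar E; x0 = ext_x0 E; x1 = ext_x1 E;
         c0 = ext_c0 E; c1 = ext_c1 E; l = ext_lam E in
      B x0 x0 = 0 \<and>
      (\<forall>X\<in>scarrier H. supercomm s 1 0 \<delta> D X - s l (Db X) = brk H c1 X) \<and>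
      (\<forall>X\<in>scarrier H. supercomm s 1 1 \<delta> Db X + s l (D X) = brk H c0 X) \<and>
      \<delta> x0 = - s (2 * l) x1 - s 2 (Db c0) \<and>
      \<delta> x1 = s l x0 + D c0 + Db c1 \<and>
      l * ext_k E = B c0 x0)"

definition odd_ext_data ::
  "('k::field \<Rightarrow> 'v \<Rightarrow> 'v) \<Rightarrow> ('v::ab_group_add) superalgebra \<Rightarrow>
    ('v \<Rightarrow> 'v \<Rightarrow> 'k) \<Rightarrow> ('v \<Rightarrow> 'v \<Rightarrow> 'k) \<Rightarrow> ('k, 'v) ext_data \<Rightarrow> bool"
  where "odd_ext_data s H B \<omega> E \<longleftrightarrow>
    ext_data_common s 1 H B \<omega> E \<and>
    (let \<delta> = ext_delta E; D = ext_D E; Db = ext_Dbar E; x0 = ext_x0 E; x1 = ext_x1 E;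
         c0 = ext_c0 E; c1 = ext_c1 E; l = ext_lam E in
      B x0 x1 = 0 \<and>
      (\<forall>X\<in>scarrier H. brk H c0 X = supercomm s 1 1 \<delta> Db X - s l (D X)) \<and>
      (\<forall>X\<in>scarrier H. brk H c1 X = supercomm s 1 0 \<delta> D X + s l (Db X)) \<and>
      \<delta> x0 = - s 2 (Db c0) + s (2 * l) x1 \<and>
      \<delta> x1 = D c0 + Db c1 - s l x0 \<and>
      l * ext_k E = B c1 x0 - 2 * B x1 c0)"


section \<open>The extended superalgebra\<close>

text \<open>
  An element \<open>p\<^sub>0 e\<^sub>0\<^sup>* + p\<^sub>1 e\<^sub>1\<^sup>* + X + a\<^sub>0 e\<^sub>0 + a\<^sub>1 e\<^sub>1\<close> of \<open>\<tt> = \<bbbK>e\<^sub>0\<^sup>* \<oplus> \<bbbK>e\<^sub>1\<^sup>* \<oplus> \<hh> \<oplus> \<bbbK>e\<^sub>0 \<oplus> \<bbbK>e\<^sub>1\<close> is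
  the tuple \<open>(p\<^sub>0, p\<^sub>1, X, a\<^sub>0, a\<^sub>1)\<close>.
\<close>

type_synonym ('k, 'v) ext = "'k \<times> 'k \<times> 'v \<times> 'k \<times> 'k"

definition ext_scale ::
  "('k::field \<Rightarrow> 'v \<Rightarrow> 'v) \<Rightarrow> 'k \<Rightarrow> ('k, 'v::ab_group_add) ext \<Rightarrow> ('k, 'v) ext"
  where "ext_scale s c = (\<lambda>(p0, p1, X, a0, a1). (c * p0, c * p1, s c X, c * a0, c * a1))"

definition ext_e0s :: "('k::field, 'v::ab_group_add) ext" where "ext_e0s = (1, 0, 0, 0, 0)"
definition ext_e1s :: "('k::field, 'v::ab_group_add) ext" where "ext_e1s = (0, 1, 0, 0, 0)"
definition ext_e0 :: "('k::field, 'v::ab_group_add) ext" where "ext_e0 = (0, 0, 0, 1, 0)"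
definition ext_e1 :: "('k::field, 'v::ab_group_add) ext" where "ext_e1 = (0, 0, 0, 0, 1)"
definition ext_in :: "'v::ab_group_add \<Rightarrow> ('k::field, 'v) ext" where "ext_in X = (0, 0, X, 0, 0)"

definition ext_part :: "('v::ab_group_add) superalgebra \<Rightarrow> bit \<Rightarrow> ('k::field, 'v) ext set"
  where "ext_part H d =
    (if d = 0 then {(p, 0, X, a, 0) | p X a. X \<in> part H 0}
     else {(0, p, X, 0, a) | p X a. X \<in> part H 1})"

text \<open>
  The bilinear, super-skew-symmetric bracket determined by its values \<open>hh X Y = [X, Y]\<close>,
  \<open>f0 X = [e\<^sub>0, X]\<close>, \<open>f1 X = [e\<^sub>1, X]\<close>, \<open>e01 = [e\<^sub>0, e\<^sub>1]\<close>, \<open>e11 = [e\<^sub>1, e\<^sub>1]\<close>, with \<open>e\<^sub>0\<^sup>*\<close>, \<open>e\<^sub>1\<^sup>*\<close>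
  central and \<open>[e\<^sub>0, e\<^sub>0] = 0\<close>. The parity involution accounts for
  \<open>[X, e\<^sub>1] = -(-1)\<^bsup>|X|\<^esup> [e\<^sub>1, X]\<close>.
\<close>

definition ext_bracket ::
  "('k::field \<Rightarrow> 'v \<Rightarrow> 'v) \<Rightarrow> ('v::ab_group_add) superalgebra \<Rightarrow>
    ('v \<Rightarrow> 'v \<Rightarrow> ('k, 'v) ext) \<Rightarrow> ('v \<Rightarrow> ('k, 'v) ext) \<Rightarrow> ('v \<Rightarrow> ('k, 'v) ext) \<Rightarrow>
    ('k, 'v) ext \<Rightarrow> ('k, 'v) ext \<Rightarrow> ('k, 'v) ext \<Rightarrow> ('k, 'v) ext \<Rightarrow> ('k, 'v) ext"
  where "ext_bracket s H hh f0 f1 e01 e11 =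
    (\<lambda>(p0, p1, X, a0, a1) (q0, q1, Y, b0, b1).
      hh X Y
      + ext_scale s a0 (f0 Y) - ext_scale s b0 (f0 X)
      + ext_scale s a1 (f1 Y) - ext_scale s b1 (f1 (parity_inv H X))
      + ext_scale s (a0 * b1 - a1 * b0) e01 + ext_scale s (a1 * b1) e11)"

text \<open>The linear map with the given values on \<open>e\<^sub>0\<^sup>*\<close>, \<open>e\<^sub>1\<^sup>*\<close>, \<open>\<hh>\<close>, \<open>e\<^sub>0\<close>, \<open>e\<^sub>1\<close>.\<close>

definition ext_linear ::
  "('k::field \<Rightarrow> 'v \<Rightarrow> 'v) \<Rightarrow> ('k, 'v::ab_group_add) ext \<Rightarrow> ('k, 'v) ext \<Rightarrow>
    ('v \<Rightarrow> ('k, 'v) ext) \<Rightarrow> ('k, 'v) ext \<Rightarrow> ('k, 'v) ext \<Rightarrow> ('k, 'v) ext \<Rightarrow> ('k, 'v) ext"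
  where "ext_linear s v0s v1s g v0 v1 =
    (\<lambda>(p0, p1, X, a0, a1). ext_scale s p0 v0s + ext_scale s p1 v1s + g X
       + ext_scale s a0 v0 + ext_scale s a1 v1)"

subsection \<open>Generalized double extension\<close>

definition even_ext ::
  "('k::field \<Rightarrow> 'v \<Rightarrow> 'v) \<Rightarrow> ('v::ab_group_add) superalgebra \<Rightarrow> ('v \<Rightarrow> 'v \<Rightarrow> 'k) \<Rightarrow>
    ('k, 'v) ext_data \<Rightarrow> (('k, 'v) ext) superalgebra"
  where "even_ext s H B E =
    (let D = ext_D E; Db = ext_Dbar E; x0 = ext_x0 E; x1 = ext_x1 E; sc = ext_scale s in
      \<lparr>part = ext_part H,
       brk = ext_bracket s H
         (\<lambda>X Y. ext_in (brk H X Y) - sc (B (Db X) Y) ext_e1s + sc (B (D X) Y) ext_e0s)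
         (\<lambda>X. ext_in (D X) + sc (B x1 X) ext_e1s)
         (\<lambda>X. ext_in (Db X) - sc (B x0 X) ext_e1s + sc (B x1 X) ext_e0s)
         (sc (ext_k E) ext_e1s + ext_in x1)
         (sc (ext_k E) ext_e0s + ext_in x0)\<rparr>)"

text \<open>By supersymmetry \<open>\<gamma>(e\<^sub>1, e\<^sub>1\<^sup>*) = -1\<close>.\<close>

definition even_ext_form ::
  "('v::ab_group_add \<Rightarrow> 'v \<Rightarrow> 'k::field) \<Rightarrow> ('k, 'v) ext \<Rightarrow> ('k, 'v) ext \<Rightarrow> 'k"
  where "even_ext_form B =
    (\<lambda>(p0, p1, X, a0, a1) (q0, q1, Y, b0, b1).
       B X Y + p0 * b0 + a0 * q0 + p1 * b1 - a1 * q1)"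

definition even_ext_derivation ::
  "('k::field \<Rightarrow> 'v \<Rightarrow> 'v) \<Rightarrow> ('v::ab_group_add \<Rightarrow> 'v \<Rightarrow> 'k) \<Rightarrow> ('k, 'v) ext_data \<Rightarrow>
    ('k, 'v) ext \<Rightarrow> ('k, 'v) ext"
  where "even_ext_derivation s B E =
    (let c0 = ext_c0 E; c1 = ext_c1 E; l = ext_lam E; \<alpha> = ext_al E; sc = ext_scale s in
      ext_linear s
        (sc l ext_e1s)
        (sc l ext_e0s)
        (\<lambda>X. - sc (B c1 X) ext_e0s + ext_in (ext_delta E X) - sc (B c0 X) ext_e1s)
        (sc \<alpha> ext_e1s + ext_in c1 + sc l ext_e1)
        (- sc \<alpha> ext_e0s + ext_in c0 - sc l ext_e0))"

subsection \<open>Generalized odd double extension\<close>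

definition odd_ext ::
  "('k::field \<Rightarrow> 'v \<Rightarrow> 'v) \<Rightarrow> ('v::ab_group_add) superalgebra \<Rightarrow> ('v \<Rightarrow> 'v \<Rightarrow> 'k) \<Rightarrow>
    ('k, 'v) ext_data \<Rightarrow> (('k, 'v) ext) superalgebra"
  where "odd_ext s H B E =
    (let D = ext_D E; Db = ext_Dbar E; x0 = ext_x0 E; x1 = ext_x1 E; sc = ext_scale s in
      \<lparr>part = ext_part H,
       brk = ext_bracket s H
         (\<lambda>X Y. ext_in (brk H X Y) + sc (B (Db X) Y) ext_e0s + sc (B (D X) Y) ext_e1s)
         (\<lambda>X. ext_in (D X) - sc (B x1 X) ext_e0s)
         (\<lambda>X. ext_in (Db X) + sc (B x0 X) ext_e0s + sc (B x1 X) ext_e1s)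
         (ext_in x1)
         (sc (ext_k E) ext_e0s + ext_in x0)\<rparr>)"

definition odd_ext_form ::
  "('v::ab_group_add \<Rightarrow> 'v \<Rightarrow> 'k::field) \<Rightarrow> ('k, 'v) ext \<Rightarrow> ('k, 'v) ext \<Rightarrow> 'k"
  where "odd_ext_form B =
    (\<lambda>(p0, p1, X, a0, a1) (q0, q1, Y, b0, b1).
       B X Y + p0 * b1 + a1 * q0 + p1 * b0 + a0 * q1)"

definition odd_ext_derivation ::
  "('k::field \<Rightarrow> 'v \<Rightarrow> 'v) \<Rightarrow> ('v::ab_group_add \<Rightarrow> 'v \<Rightarrow> 'k) \<Rightarrow> ('k, 'v) ext_data \<Rightarrow>
    ('k, 'v) ext \<Rightarrow> ('k, 'v) ext"
  where "odd_ext_derivation s B E =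
    (let c0 = ext_c0 E; c1 = ext_c1 E; l = ext_lam E; \<alpha> = ext_al E; sc = ext_scale s in
      ext_linear s
        (sc l ext_e1s)
        (sc l ext_e0s)
        (\<lambda>X. sc (B c0 X) ext_e0s + ext_in (ext_delta E X) - sc (B c1 X) ext_e1s)
        (ext_in c1 - sc l ext_e1)
        (sc \<alpha> ext_e0s + ext_in c0 + sc l ext_e0))"

subsection \<open>Isomorphisms preserving both forms\<close>

definition lie_bi_isometry ::
  "('k::field \<Rightarrow> 'u \<Rightarrow> 'u) \<Rightarrow> ('u::ab_group_add) superalgebra \<Rightarrow>
      ('u \<Rightarrow> 'u \<Rightarrow> 'k) \<Rightarrow> ('u \<Rightarrow> 'u \<Rightarrow> 'k) \<Rightarrow>
    ('k \<Rightarrow> 'w \<Rightarrow> 'w) \<Rightarrow> ('w::ab_group_add) superalgebra \<Rightarrow>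
      ('w \<Rightarrow> 'w \<Rightarrow> 'k) \<Rightarrow> ('w \<Rightarrow> 'w \<Rightarrow> 'k) \<Rightarrow> ('u \<Rightarrow> 'w) \<Rightarrow> bool"
  where "lie_bi_isometry s G B \<omega> s' T \<gamma> \<Omega> \<phi> \<longleftrightarrow>
    linear_on s s' (scarrier G) \<phi> \<and> bij_betw \<phi> (scarrier G) (scarrier T) \<and>
    (\<forall>d. \<phi> ` part G d \<subseteq> part T d) \<and>
    (\<forall>x\<in>scarrier G. \<forall>y\<in>scarrier G.
       \<phi> (brk G x y) = brk T (\<phi> x) (\<phi> y) \<and> B x y = \<gamma> (\<phi> x) (\<phi> y) \<and> \<omega> x y = \<Omega> (\<phi> x) (\<phi> y))"

definition is_generalized_double_extension ::
  "('k::field \<Rightarrow> 'v \<Rightarrow> 'v) \<Rightarrow> ('v::ab_group_add) superalgebra \<Rightarrow>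
      ('v \<Rightarrow> 'v \<Rightarrow> 'k) \<Rightarrow> ('v \<Rightarrow> 'v \<Rightarrow> 'k) \<Rightarrow>
    'v superalgebra \<Rightarrow> ('v \<Rightarrow> 'v \<Rightarrow> 'k) \<Rightarrow> ('v \<Rightarrow> 'v \<Rightarrow> 'k) \<Rightarrow> bool"
  where "is_generalized_double_extension s G B \<omega> H B\<^sub>H \<omega>\<^sub>H \<longleftrightarrow>
    (\<exists>E \<phi>. even_ext_data s H B\<^sub>H \<omega>\<^sub>H E \<and>
       lie_bi_isometry s G B \<omega> (ext_scale s) (even_ext s H B\<^sub>H E) (even_ext_form B\<^sub>H)
         (\<lambda>u v. even_ext_form B\<^sub>H (even_ext_derivation s B\<^sub>H E u) v) \<phi>)"

definition is_generalized_odd_double_extension ::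
  "('k::field \<Rightarrow> 'v \<Rightarrow> 'v) \<Rightarrow> ('v::ab_group_add) superalgebra \<Rightarrow>
      ('v \<Rightarrow> 'v \<Rightarrow> 'k) \<Rightarrow> ('v \<Rightarrow> 'v \<Rightarrow> 'k) \<Rightarrow>
    'v superalgebra \<Rightarrow> ('v \<Rightarrow> 'v \<Rightarrow> 'k) \<Rightarrow> ('v \<Rightarrow> 'v \<Rightarrow> 'k) \<Rightarrow> bool"
  where "is_generalized_odd_double_extension s G B \<omega> H B\<^sub>H \<omega>\<^sub>H \<longleftrightarrow>
    (\<exists>E \<phi>. odd_ext_data s H B\<^sub>H \<omega>\<^sub>H E \<and>
       lie_bi_isometry s G B \<omega> (ext_scale s) (odd_ext s H B\<^sub>H E) (odd_ext_form B\<^sub>H)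
         (\<lambda>u v. odd_ext_form B\<^sub>H (odd_ext_derivation s B\<^sub>H E u) v) \<phi>)"

section \<open>Basic facts\<close>

lemma parity_inv_homogeneous:
  assumes "vector_space s" and "lie_superalgebra s H" and x: "x \<in> part H d"
  shows "parity_inv H x = s (ksign d) x"
proof -
  interpret vector_space s by fact
  have sub: "\<And>e. subspace (part H e)" and int: "part H 0 \<inter> part H 1 = {0}"
    using assms(2) unfolding lie_superalgebra_def by blast+
  have uniq: "u = u' \<and> v = v'"
    if "u \<in> part H 0" "u' \<in> part H 0" "v \<in> part H 1" "v' \<in> part H 1" "u + v = u' + v'" for u u' v v'
  proof -
    have "u - u' \<in> part H 0" "v' - v \<in> part H 1" using that sub subspace_diff by blast+
    moreover have "u - u' = v' - v" using that(5) by (simp add: algebra_simps)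
    ultimately have "u - u' \<in> part H 0 \<inter> part H 1" by simp
    then have "u - u' = 0" using int by blast
    then show ?thesis using that(5) by simp
  qed
  have z: "0 \<in> part H e" for e using sub subspace_0 by blast
  have eq: "parity_inv H x = u - v" if "u \<in> part H 0" "v \<in> part H 1" "x = u + v" for u v
    unfolding parity_inv_def
  proof (rule the_equality)
    show "\<exists>u'\<in>part H 0. \<exists>v'\<in>part H 1. x = u' + v' \<and> u - v = u' - v'" using that by blast
  next
    fix y assume "\<exists>u'\<in>part H 0. \<exists>v'\<in>part H 1. x = u' + v' \<and> y = u' - v'"
    then show "y = u - v" using that uniq by metis
  qed
  show ?thesis
  proof (cases "d = 0")
    case True then show ?thesis using eq[of x 0] x z by (simp add: ksign_def)
  next
    case False then show ?thesis using eq[of 0 x] x z by (simp add: ksign_def)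
  qed
qed

lemma linear_on_zero: "linear_on s s' V f \<Longrightarrow> 0 \<in> V \<Longrightarrow> f 0 = 0"
  unfolding linear_on_def by (metis add_0 add_cancel_left_left)

lemma scarrier_zero:
  assumes "vector_space s" and "lie_superalgebra s H"
  shows "0 \<in> scarrier H" and "part H d \<subseteq> scarrier H"
proof -
  interpret vector_space s by fact
  have z: "0 \<in> part H e" for e
    using assms(2) subspace_0 unfolding lie_superalgebra_def by blast
  show "0 \<in> scarrier H" using z unfolding scarrier_def by force
  show "part H d \<subseteq> scarrier H"
  proof (cases "d = 0")
    case True then show ?thesis using z[of 1] unfolding scarrier_def by force
  next
    case False then show ?thesis using z[of 0] unfolding scarrier_def by force
  qed
qed

text \<open>The bracket and the derivation of the extension take the prescribed values.\<close>

context
  fixes s :: "'k::field \<Rightarrow> 'v::ab_group_add \<Rightarrow> 'v" and H B \<omega> and E :: "('k, 'v) ext_data" and p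
  assumes vs: "vector_space s" and common: "ext_data_common s p H B \<omega> E"
begin

interpretation vector_space s by (rule vs)

lemma ext_lin_zeros:
  "X \<in> scarrier H \<Longrightarrow> brk H X 0 = 0" "X \<in> scarrier H \<Longrightarrow> brk H 0 X = 0"
  "X \<in> scarrier H \<Longrightarrow> B X 0 = 0" "X \<in> scarrier H \<Longrightarrow> B 0 X = 0"
  "ext_D E 0 = 0" "ext_Dbar E 0 = 0" "ext_delta E 0 = 0" "0 \<in> scarrier H"
  "ext_x0 E \<in> scarrier H" "ext_x1 E \<in> scarrier H" "ext_c0 E \<in> scarrier H" "ext_c1 E \<in> scarrier H"
  "parity_inv H 0 = 0"
  "X \<in> scarrier H \<Longrightarrow> ext_D E X \<in> scarrier H" "X \<in> scarrier H \<Longrightarrow> ext_Dbar E X \<in> scarrier H"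
proof -
  have lie: "lie_superalgebra s H" using common by (simp add: ext_data_common_def Let_def)
  note z = scarrier_zero[OF vs lie]
  have bil: "bilinear_on s s (scarrier H) (brk H)" "bilinear_on s (*) (scarrier H) B"
    using common by (auto simp: ext_data_common_def Let_def lie_superalgebra_def quadratic_def)
  show "X \<in> scarrier H \<Longrightarrow> brk H X 0 = 0" "X \<in> scarrier H \<Longrightarrow> B X 0 = 0"
    using bil z linear_on_zero unfolding bilinear_on_def by blast+
  show "brk H 0 X = 0" if "X \<in> scarrier H"
  proof -
    have "linear_on s s (scarrier H) (\<lambda>x. brk H x X)" using bil(1) that unfolding bilinear_on_def by blast
    from linear_on_zero[OF this] z show ?thesis by simp
  qed
  show "B 0 X = 0" if "X \<in> scarrier H"
  proof -
    have "linear_on s (*) (scarrier H) (\<lambda>x. B x X)" using bil(2) that unfolding bilinear_on_def by blast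
    from linear_on_zero[OF this] z show ?thesis by simp
  qed
  have der: "superderivation s 0 H (ext_D E)" "superderivation s 1 H (ext_Dbar E)"
    "superderivation s 1 H (ext_delta E)"
    using common by (auto simp: ext_data_common_def Let_def symplectic_derivation_def)
  have der0: "f 0 = 0" if "superderivation s d H f" for f d
    using that linear_on_zero[OF _ z(1)] unfolding superderivation_def by metis
  show "ext_D E 0 = 0" "ext_Dbar E 0 = 0" "ext_delta E 0 = 0"
    by (rule der0, rule der)+
  show "0 \<in> scarrier H" by (rule z)
  show "ext_x0 E \<in> scarrier H" "ext_x1 E \<in> scarrier H" "ext_c0 E \<in> scarrier H" "ext_c1 E \<in> scarrier H"
    using common z by (auto simp: ext_data_common_def Let_def)
  have "0 \<in> part H 0" using lie subspace_0 by (auto simp: lie_superalgebra_def)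
  from parity_inv_homogeneous[OF vs lie this] show "parity_inv H 0 = 0" by (simp add: ksign_def)
  have map: "f X \<in> scarrier H" if f: "superderivation s d H f" and X: "X \<in> scarrier H" for f d X
  proof -
    obtain u v where uv: "u \<in> part H 0" "v \<in> part H 1" "X = u + v"
      using X unfolding scarrier_def by blast
    have fu: "f u \<in> part H (0 + d)" and fv: "f v \<in> part H (1 + d)"
      using f uv unfolding superderivation_def by blast+
    have fX: "f X = f u + f v"
    proof -
      have "u \<in> scarrier H" "v \<in> scarrier H" using uv z(2) by auto
      then show ?thesis using f uv(3) unfolding superderivation_def linear_on_def by simp
    qed
    then have "f X = f v + f u" by (simp add: add.commute)
    show ?thesis
    proof (cases "d = 0")
      case True
      then have "f u \<in> part H 0" "f v \<in> part H 1" using fu fv by simp_all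
      with fX show ?thesis unfolding scarrier_def by blast
    next
      case False
      then have "d = 1" by simp
      then have "f u \<in> part H 1" "f v \<in> part H 0" using fu fv by simp_all
      with \<open>f X = f v + f u\<close> show ?thesis unfolding scarrier_def by blast
    qed
  qed
  show "X \<in> scarrier H \<Longrightarrow> ext_D E X \<in> scarrier H" "X \<in> scarrier H \<Longrightarrow> ext_Dbar E X \<in> scarrier H"
    by (rule map, rule der, assumption)+
qed

lemmas ext_elem_simps = ext_scale_def ext_e0s_def ext_e1s_def ext_e0_def ext_e1_def ext_in_def
  zero_prod_def

lemma even_ext_values:
  assumes "X \<in> scarrier H" "Y \<in> scarrier H"
  shows "brk (even_ext s H B E) (ext_in X) (ext_in Y) =
      ext_in (brk H X Y) - ext_scale s (B (ext_Dbar E X) Y) ext_e1s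
        + ext_scale s (B (ext_D E X) Y) ext_e0s"
    and "brk (even_ext s H B E) ext_e0 (ext_in X) =
      ext_in (ext_D E X) + ext_scale s (B (ext_x1 E) X) ext_e1s"
    and "brk (even_ext s H B E) ext_e1 (ext_in X) =
      ext_in (ext_Dbar E X) - ext_scale s (B (ext_x0 E) X) ext_e1s
        + ext_scale s (B (ext_x1 E) X) ext_e0s"
    and "brk (even_ext s H B E) ext_e0 ext_e0 = 0"
    and "brk (even_ext s H B E) ext_e1 ext_e1 = ext_scale s (ext_k E) ext_e0s + ext_in (ext_x0 E)"
    and "brk (even_ext s H B E) ext_e0 ext_e1 = ext_scale s (ext_k E) ext_e1s + ext_in (ext_x1 E)"
  using assms
  by (simp_all add: even_ext_def Let_def ext_bracket_def ext_elem_simps ext_lin_zeros)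

lemma even_ext_derivation_values:
  assumes "X \<in> scarrier H"
  shows "even_ext_derivation s B E ext_e0s = ext_scale s (ext_lam E) ext_e1s"
    and "even_ext_derivation s B E ext_e1s = ext_scale s (ext_lam E) ext_e0s"
    and "even_ext_derivation s B E ext_e0 =
      ext_scale s (ext_al E) ext_e1s + ext_in (ext_c1 E) + ext_scale s (ext_lam E) ext_e1"
    and "even_ext_derivation s B E ext_e1 =
      - ext_scale s (ext_al E) ext_e0s + ext_in (ext_c0 E) - ext_scale s (ext_lam E) ext_e0"
    and "even_ext_derivation s B E (ext_in X) =
      - ext_scale s (B (ext_c1 E) X) ext_e0s + ext_in (ext_delta E X)
        - ext_scale s (B (ext_c0 E) X) ext_e1s"
  using assms
  by (simp_all add: even_ext_derivation_def Let_def ext_linear_def ext_elem_simps ext_lin_zeros)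

lemma odd_ext_values:
  assumes "X \<in> scarrier H" "Y \<in> scarrier H"
  shows "brk (odd_ext s H B E) (ext_in X) (ext_in Y) =
      ext_in (brk H X Y) + ext_scale s (B (ext_Dbar E X) Y) ext_e0s
        + ext_scale s (B (ext_D E X) Y) ext_e1s"
    and "brk (odd_ext s H B E) ext_e0 (ext_in X) =
      ext_in (ext_D E X) - ext_scale s (B (ext_x1 E) X) ext_e0s"
    and "brk (odd_ext s H B E) ext_e1 (ext_in X) =
      ext_in (ext_Dbar E X) + ext_scale s (B (ext_x0 E) X) ext_e0s
        + ext_scale s (B (ext_x1 E) X) ext_e1s"
    and "brk (odd_ext s H B E) ext_e0 ext_e0 = 0"
    and "brk (odd_ext s H B E) ext_e1 ext_e1 = ext_scale s (ext_k E) ext_e0s + ext_in (ext_x0 E)"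
    and "brk (odd_ext s H B E) ext_e0 ext_e1 = ext_in (ext_x1 E)"
  using assms
  by (simp_all add: odd_ext_def Let_def ext_bracket_def ext_elem_simps ext_lin_zeros)

lemma odd_ext_derivation_values:
  assumes "X \<in> scarrier H"
  shows "odd_ext_derivation s B E ext_e0s = ext_scale s (ext_lam E) ext_e1s"
    and "odd_ext_derivation s B E ext_e1s = ext_scale s (ext_lam E) ext_e0s"
    and "odd_ext_derivation s B E ext_e0 = ext_in (ext_c1 E) - ext_scale s (ext_lam E) ext_e1"
    and "odd_ext_derivation s B E ext_e1 =
      ext_scale s (ext_al E) ext_e0s + ext_in (ext_c0 E) + ext_scale s (ext_lam E) ext_e0"
    and "odd_ext_derivation s B E (ext_in X) =
      ext_scale s (B (ext_c0 E) X) ext_e0s + ext_in (ext_delta E X)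
        - ext_scale s (B (ext_c1 E) X) ext_e1s"
  using assms
  by (simp_all add: odd_ext_derivation_def Let_def ext_linear_def ext_elem_simps ext_lin_zeros)

end

end

theory Submission
  imports Defs
begin

text \<open>
  Suppose that the center meets \<open>\<aa>\<close>; the two halves \<open>\<aa>\<close> and \<open>\<bb>\<close> play symmetric roles. The derivation
  \<open>\<Delta>\<close> preserves the center and \<open>\<aa>\<close>, and its square acts on the even central vectors of \<open>\<aa>\<close>. Over an
  algebraically closed field this square has an eigenvector \<open>u0\<close> there, with eigenvalue \<open>l\<^sup>2 \<noteq> 0\<close>, and
  \<open>u1 = \<Delta> u0 / l\<close> completes it to a \<open>\<Delta>\<close>-stable central plane on which \<open>\<Delta>\<close> exchanges \<open>u0\<close> and \<open>u1\<close> up to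
  the factor \<open>l\<close> (\<open>double_extension_frame_exists\<close>). This is the span of \<open>e\<^sub>0\<^sup>*\<close> and \<open>e\<^sub>1\<^sup>*\<close>.

  Since \<open>B\<close> pairs \<open>\<aa>\<close> with \<open>\<bb>\<close> non-degenerately, dual vectors \<open>e0\<close>, \<open>e1\<close> can be chosen in \<open>\<bb>\<close>. The
  superalgebra \<open>H\<close> lives on the orthogonal complement of the four vectors, with the bracket of \<open>G\<close>
  followed by orthogonal projection. It represents the quotient of the orthogonal of the central plane
  by that plane, so it inherits both forms, the derivation and, by isotropy, the Manin decomposition
  (\<open>special_manin_H\<close>). The key simplification is that brackets lie in the orthogonal of the plane, where
  the projection only removes central elements: projections inside brackets can be dropped
  (\<open>br_pr\<close>, \<open>pr_\<Delta>_pr\<close>).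

  The extension data are the projections of the adjoint actions of \<open>e0\<close>, \<open>e1\<close> and of the elements
  \<open>[e1, e1]\<close>, \<open>[e0, e1]\<close>, \<open>\<Delta> e1\<close>, \<open>\<Delta> e0\<close>. Their relations are projected Jacobi identities and derivation
  rules, and the scalar conditions are trivial because \<open>\<bb>\<close> is isotropic and stable under bracket and
  \<open>\<Delta>\<close> (\<open>even_ext_data_E\<close>, \<open>odd_ext_data_E\<close>). Taking coordinates is then an isomorphism onto the
  extension, because invariance of \<open>B\<close> determines the central components of all brackets
  (\<open>even_isometry\<close>, \<open>odd_isometry\<close>).
\<close>

section \<open>Linear algebra on subspaces\<close>

lemma linear_on_sum:
  assumes "module.subspace s V" "vector_space s" "linear_on s s' V T" "finite I"
    and "\<And>i. i \<in> I \<Longrightarrow> f i \<in> V"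
  shows "T (\<Sum>i\<in>I. f i) = (\<Sum>i\<in>I. T (f i))"
proof -
  interpret vector_space s by fact
  show ?thesis using assms(4,5)
  proof (induction I rule: finite_induct)
    case empty
    then show ?case using linear_on_zero[OF assms(3)] subspace_0[OF assms(1)] by simp
  next
    case (insert i I)
    then show ?case
      using assms(3) subspace_sum[OF assms(1), of I f] by (auto simp: linear_on_def)
  qed
qed

context vector_space
begin

text \<open>Finite dimensionality passes to subspaces: a basis of the smaller space is an independent
  subset of the larger one.\<close>

lemma subspace_finitely_spanned:
  assumes "subspace W" "finite S" "W \<subseteq> span S"
  shows "\<exists>S'. finite S' \<and> span S' = W"
proof -
  obtain C where C: "C \<subseteq> W" "independent C" "W \<subseteq> span C"
    using maximal_independent_subset[of W] by blast
  have "finite C" using independent_span_bound[OF assms(2) C(2)] C(1) assms(3) by blast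
  moreover have "span C = W" using C span_minimal[OF C(1) assms(1)] by blast
  ultimately show ?thesis by blast
qed

text \<open>More vectors than the dimension admit a non-trivial relation; for a sequence, a repetition
  among its members has to be treated apart, since dependence is a property of their set.\<close>

lemma sequence_relation:
  assumes "finite S" "\<And>i. v i \<in> span S"
  shows "\<exists>c (N::nat). (\<exists>i<N. c i \<noteq> 0) \<and> (\<Sum>i<N. scale (c i) (v i)) = 0"
proof -
  define N where "N = Suc (card S)"
  show ?thesis
  proof (cases "inj_on v {..<N}")
    case True
    have "dependent (v ` {..<N})"
    proof (rule ccontr)
      assume "independent (v ` {..<N})"
      then have "card (v ` {..<N}) \<le> card S"
        using independent_span_bound[OF assms(1)] assms(2) by blast
      then show False using card_image[OF True] by (simp add: N_def)
    qed
    then obtain u where u: "\<exists>x\<in>v ` {..<N}. u x \<noteq> 0" "(\<Sum>x\<in>v ` {..<N}. scale (u x) x) = 0"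
      using dependent_finite[of "v ` {..<N}"] by auto
    then have "(\<Sum>i<N. scale (u (v i)) (v i)) = 0" using True by (simp add: sum.reindex)
    then show ?thesis using u(1) by (intro exI[of _ "\<lambda>i. u (v i)"] exI[of _ N]) auto
  next
    case False
    then obtain i j where ij: "i < N" "j < N" "i \<noteq> j" "v i = v j" by (auto simp: inj_on_def)
    let ?c = "\<lambda>k. if k = i then 1 else if k = j then -1 else 0 :: 'a"
    have "(\<Sum>k<N. scale (?c k) (v k)) = (\<Sum>k\<in>{i, j}. scale (?c k) (v k))"
      using ij by (intro sum.mono_neutral_right) auto
    also have "\<dots> = 0" using ij by simp
    finally show ?thesis using ij by (intro exI[of _ ?c] exI[of _ N]) (auto intro!: exI[of _ i])
  qed
qed

end

text \<open>A relation between the iterates \<open>T\<^sup>i x\<close> is a polynomial annihilating \<open>x\<close>. Its linear factors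
  are stripped off one by one; the last non-zero vector produced on the way is an eigenvector.\<close>

lemma eigenvector_of_annihilating_poly:
  fixes s :: "'k::alg_closed_field \<Rightarrow> 'v::ab_group_add \<Rightarrow> 'v"
  assumes vs: "vector_space s" and sub: "module.subspace s W"
    and lin: "linear_on s s W T" and inv: "\<And>y. y \<in> W \<Longrightarrow> T y \<in> W"
    and x: "x \<in> W" "x \<noteq> 0"
    and q: "q \<noteq> 0" "degree q < N" "(\<Sum>i<N. s (coeff q i) ((T ^^ i) x)) = 0"
  shows "\<exists>\<mu>. \<exists>y\<in>W. y \<noteq> 0 \<and> T y = s \<mu> y"
  using q
proof (induction "degree q" arbitrary: q N)
  case 0
  interpret vector_space s by fact
  obtain c where c: "q = [:c:]" using 0(1) degree_eq_zeroE by metis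
  obtain M where M: "N = Suc M" using "0.prems"(2) by (cases N) auto
  have "(\<Sum>i<N. s (coeff q i) ((T ^^ i) x)) = s c x"
    unfolding M sum.lessThan_Suc_shift by (simp add: c)
  then show ?case using "0.prems" c x by simp
next
  case (Suc n)
  interpret vector_space s by fact
  have iter: "(T ^^ i) x \<in> W" for i by (induction i) (use x inv in auto)
  obtain r where "poly q r = 0" using alg_closed_imp_poly_has_root[of q] Suc(2) by auto
  then obtain q' where q': "q = [:- r, 1:] * q'" using poly_eq_0_iff_dvd by (metis dvdE)
  have q'0: "q' \<noteq> 0" using q' Suc.prems(1) by auto
  have deg: "degree q = Suc (degree q')"
    using degree_mult_eq[of "[:- r, 1:]" q'] q'0 unfolding q' by (simp del: mult_pCons_left)
  obtain M where M: "N = Suc M" "degree q' < M" using deg Suc.prems(2) by (cases N) auto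
  define y where "y = (\<Sum>i<M. s (coeff q' i) ((T ^^ i) x))"
  have yW: "y \<in> W" unfolding y_def using iter by (intro subspace_sum sub subspace_scale)
  have q_eq: "q = pCons 0 q' - smult r q'" using q' by simp
  have "(\<Sum>i<N. s (coeff q i) ((T ^^ i) x)) =
      (\<Sum>i<N. s (coeff (pCons 0 q') i) ((T ^^ i) x)) - s r (\<Sum>i<N. s (coeff q' i) ((T ^^ i) x))"
    unfolding q_eq by (simp add: scale_left_diff_distrib sum_subtractf scale_sum_right)
  also have "(\<Sum>i<N. s (coeff (pCons 0 q') i) ((T ^^ i) x)) = T y"
    unfolding M(1) sum.lessThan_Suc_shift y_def
    using linear_on_sum[OF sub vs lin, of "{..<M}" "\<lambda>i. s (coeff q' i) ((T ^^ i) x)"]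
      iter subspace_scale[OF sub] lin
    by (simp add: linear_on_def)
  also have "(\<Sum>i<N. s (coeff q' i) ((T ^^ i) x)) = y"
    unfolding M(1) y_def using M(2) by (simp add: coeff_eq_0)
  finally have "T y = s r y" using Suc.prems(3) by simp
  show ?case
  proof (cases "y = 0")
    case True
    then show ?thesis using Suc.hyps(1)[of q' M] Suc.hyps(2) deg q'0 M(2) y_def by simp
  next
    case False
    then show ?thesis using yW \<open>T y = s r y\<close> by blast
  qed
qed

lemma eigenvector_exists:
  fixes s :: "'k::alg_closed_field \<Rightarrow> 'v::ab_group_add \<Rightarrow> 'v"
  assumes vs: "vector_space s" and sub: "module.subspace s W"
    and fin: "finite S" "W \<subseteq> module.span s S"
    and lin: "linear_on s s W T" and inv: "\<And>y. y \<in> W \<Longrightarrow> T y \<in> W"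
    and x: "x \<in> W" "x \<noteq> 0"
  shows "\<exists>\<mu>. \<exists>y\<in>W. y \<noteq> 0 \<and> T y = s \<mu> y"
proof -
  interpret vector_space s by fact
  have "(T ^^ i) x \<in> W" for i by (induction i) (use x inv in auto)
  then have "(T ^^ i) x \<in> span S" for i using fin by blast
  then obtain c and N :: nat
    where c: "\<exists>i<N. c i \<noteq> 0" "(\<Sum>i<N. s (c i) ((T ^^ i) x)) = 0"
    using sequence_relation[OF fin(1), of "\<lambda>i. (T ^^ i) x"] by blast
  define q where "q = (\<Sum>i<N. monom (c i) i)"
  have co: "coeff q i = (if i < N then c i else 0)" for i
    by (simp add: q_def coeff_sum)
  have "q \<noteq> 0" using c(1) co by (metis coeff_0)
  moreover have "degree q < N"
    using c(1) co by (metis calculation leading_coeff_neq_0)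
  ultimately show ?thesis
    using eigenvector_of_annihilating_poly[OF vs sub lin inv x, of q N] c(2) co by simp
qed

section \<open>Calculus in a special symplectic Manin superalgebra\<close>

lemma ksign_simps [simp]:
  "ksign 0 = 1" "ksign 1 = -1" "ksign d * ksign d = 1" "ksign d * (ksign d * c) = c"
  by (auto simp: ksign_def)

lemma ksign_nonzero [simp]: "ksign d \<noteq> (0 :: 'k::field)"
  by (simp add: ksign_def)

lemma bilinear_on_add:
  assumes "bilinear_on s s' V f" "x \<in> V" "y \<in> V" "z \<in> V"
  shows "f (x + y) z = f x z + f y z" "f z (x + y) = f z x + f z y"
  using assms unfolding bilinear_on_def linear_on_def by blast+

lemma bilinear_on_scale:
  assumes "bilinear_on s s' V f" "x \<in> V" "z \<in> V"
  shows "f (s c x) z = s' c (f x z)" "f z (s c x) = s' c (f z x)"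
  using assms unfolding bilinear_on_def linear_on_def by blast+

locale symplectic_manin = vector_space s
  for s :: "'k::{alg_closed_field, field_char_0} \<Rightarrow> 'v::ab_group_add \<Rightarrow> 'v" +
  fixes p :: bit and G :: "'v superalgebra" and \<aa> \<bb> :: "'v set"
    and B \<omega> :: "'v \<Rightarrow> 'v \<Rightarrow> 'k" and \<Delta> :: "'v \<Rightarrow> 'v"
  assumes manin: "special_manin s p G \<aa> \<bb> B \<omega>"
    and sder: "symplectic_derivation s G B \<omega> \<Delta>"
    and \<Delta>_\<aa>: "\<Delta> ` \<aa> \<subseteq> \<aa>" and \<Delta>_\<bb>: "\<Delta> ` \<bb> \<subseteq> \<bb>"
begin

abbreviation "V \<equiv> scarrier G"
abbreviation "br \<equiv> brk G"

lemma lieG: "lie_superalgebra s G" and sub\<aa>: "lie_subsuperalgebra s G \<aa>"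
  and sub\<bb>: "lie_subsuperalgebra s G \<bb>" and quadG: "quadratic s p G B"
  and sympG: "symplectic s (p + 1) G \<omega>"
  using manin by (auto simp: special_manin_def)

lemma part_V: "x \<in> part G d \<Longrightarrow> x \<in> V"
  using scarrier_zero(2)[OF vector_space_axioms lieG] by blast

lemma V_zero [simp]: "0 \<in> V"
  by (rule scarrier_zero(1)[OF vector_space_axioms lieG])

lemma subspace_part: "subspace (part G d)"
  using lieG unfolding lie_superalgebra_def by blast

lemma subspace_V: "subspace V"
  unfolding scarrier_def by (intro subspace_sums subspace_part)

lemmas V_cl = subspace_add[OF subspace_V] subspace_scale[OF subspace_V]
  subspace_diff[OF subspace_V] subspace_neg[OF subspace_V]

lemma V_cases:
  assumes "x \<in> V" obtains x0 x1 where "x0 \<in> part G 0" "x1 \<in> part G 1" "x = x0 + x1"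
  using assms unfolding scarrier_def by blast

text \<open>Additive statements about the carrier need only be checked on homogeneous elements.\<close>

lemma homogeneous_induct [consumes 1, case_names hom add]:
  assumes "x \<in> V" and "\<And>d x. x \<in> part G d \<Longrightarrow> P x"
    and "\<And>x y. x \<in> V \<Longrightarrow> y \<in> V \<Longrightarrow> P x \<Longrightarrow> P y \<Longrightarrow> P (x + y)"
  shows "P x"
proof -
  obtain x0 x1 where "x0 \<in> part G 0" "x1 \<in> part G 1" "x = x0 + x1"
    using V_cases[OF assms(1)] by blast
  then show ?thesis using assms(2)[of x0 0] assms(2)[of x1 1] assms(3)[of x0 x1] part_V by blast
qed

lemma br_part: "x \<in> part G a \<Longrightarrow> y \<in> part G b \<Longrightarrow> br x y \<in> part G (a + b)"
  using lieG unfolding lie_superalgebra_def by blast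

lemma br_bil: "bilinear_on s s V br"
  using lieG unfolding lie_superalgebra_def by blast

lemmas br_lin = bilinear_on_add[OF br_bil] bilinear_on_scale[OF br_bil]

lemma br_V [simp]:
  assumes "x \<in> V" "y \<in> V" shows "br x y \<in> V"
  using assms
proof (induction x rule: homogeneous_induct)
  case (hom d x)
  from hom(2,1) show ?case
  proof (induction y rule: homogeneous_induct)
    case (hom e y)
    then show ?case using part_V[OF br_part] by blast
  next
    case (add y z)
    then show ?case using br_lin(2)[of y z x] part_V V_cl(1) by simp
  qed
next
  case (add x z)
  then show ?case using br_lin(1)[of x z y] V_cl(1) by simp
qed

lemma br_skew:
  assumes "x \<in> part G a" "y \<in> part G b" shows "br x y = - s (ksign (a * b)) (br y x)"
proof -
  have "\<forall>a b. \<forall>x\<in>part G a. \<forall>y\<in>part G b. br x y = - s (ksign (a * b)) (br y x)"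
    using lieG unfolding lie_superalgebra_def by (elim conjE)
  from this[rule_format, OF assms] show ?thesis .
qed

lemma br_skew0:
  assumes "x \<in> part G 0" "y \<in> V" shows "br x y = - br y x"
  using assms(2,1)
proof (induction y rule: homogeneous_induct)
  case (hom d y)
  then show ?case using br_skew[of x 0 y d] by simp
next
  case (add y z)
  then show ?case by (simp add: br_lin part_V)
qed

lemma jacobi:
  assumes "x \<in> part G a" "y \<in> part G b" "z \<in> V"
  shows "br x (br y z) = br (br x y) z + s (ksign (a * b)) (br y (br x z))"
  using assms(3,1,2)
proof (induction z rule: homogeneous_induct)
  case (hom d z)
  have "\<forall>a b c. \<forall>x\<in>part G a. \<forall>y\<in>part G b. \<forall>z\<in>part G c.
      br x (br y z) = br (br x y) z + s (ksign (a * b)) (br y (br x z))"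
    using lieG unfolding lie_superalgebra_def by (elim conjE)
  from this[rule_format, OF hom(2,3,1)] show ?case .
next
  case (add z z')
  then show ?case by (simp add: br_lin part_V scale_right_distrib algebra_simps)
qed

lemma B_bil: "bilinear_on s (*) V B" and \<omega>_bil: "bilinear_on s (*) V \<omega>"
  using quadG sympG unfolding quadratic_def symplectic_def by blast+

lemmas B_lin = bilinear_on_add[OF B_bil] bilinear_on_scale[OF B_bil]
lemmas \<omega>_lin = bilinear_on_add[OF \<omega>_bil] bilinear_on_scale[OF \<omega>_bil]

lemma B_neg:
  assumes "x \<in> V" "z \<in> V" shows "B (- x) z = - B x z" "B z (- x) = - B z x"
  using B_lin(3,4)[of x z "-1"] assms by simp_all

lemma B_diff:
  assumes "x \<in> V" "y \<in> V" "z \<in> V"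
  shows "B (x - y) z = B x z - B y z" "B z (x - y) = B z x - B z y"
  using B_lin(1,2)[of x "- y" z] assms V_cl(4) by (simp_all add: B_neg)

lemma B_zero [simp]: "x \<in> V \<Longrightarrow> B 0 x = 0" "x \<in> V \<Longrightarrow> B x 0 = 0"
  using B_diff(1,2)[of x x x] by simp_all

lemma B_parity: "a + b \<noteq> p \<Longrightarrow> x \<in> part G a \<Longrightarrow> y \<in> part G b \<Longrightarrow> B x y = 0"
  using quadG unfolding quadratic_def form_parity_def by blast

lemma \<omega>_parity: "a + b \<noteq> p + 1 \<Longrightarrow> x \<in> part G a \<Longrightarrow> y \<in> part G b \<Longrightarrow> \<omega> x y = 0"
  using sympG unfolding symplectic_def form_parity_def by blast

lemma B_inv: "x \<in> V \<Longrightarrow> y \<in> V \<Longrightarrow> z \<in> V \<Longrightarrow> B (br x y) z = B x (br y z)"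
  using quadG unfolding quadratic_def by (elim conjE) blast

text \<open>A homogeneous element pairs non-trivially with one degree only, so the sign of the symmetry is
  determined by that element and the parity of the form.\<close>

lemma B_swap:
  assumes "z \<in> part G d" "x \<in> V" shows "B z x = ksign (d * (p + d)) * B x z"
  using assms(2,1)
proof (induction x rule: homogeneous_induct)
  case (hom e x)
  show ?case
  proof (cases "d + e = p")
    case True
    then have "e = p + d" by (cases d; cases e; cases p) auto
    moreover have "B z x = ksign (d * e) * B x z"
    proof -
      have "\<forall>a b. \<forall>x\<in>part G a. \<forall>y\<in>part G b. B x y = ksign (a * b) * B y x"
        using quadG unfolding quadratic_def by (elim conjE)
      from this[rule_format, OF hom(2,1)] show ?thesis .
    qed
    ultimately show ?thesis by simp
  next
    case False
    then have "B z x = 0" using B_parity hom by blast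
    moreover have "B x z = 0" using False B_parity hom by (metis add.commute)
    ultimately show ?thesis by simp
  qed
next
  case (add x y)
  then show ?case by (simp add: B_lin part_V algebra_simps)
qed

lemma B_eq_0_iff: "z \<in> part G d \<Longrightarrow> x \<in> V \<Longrightarrow> B z x = 0 \<longleftrightarrow> B x z = 0"
  using B_swap[of z d x] by simp

lemma \<omega>_swap:
  assumes "z \<in> part G d" "x \<in> V" shows "\<omega> z x = - ksign (d * (p + 1 + d)) * \<omega> x z"
  using assms(2,1)
proof (induction x rule: homogeneous_induct)
  case (hom e x)
  show ?case
  proof (cases "d + e = p + 1")
    case True
    then have "e = p + 1 + d" by (cases d; cases e; cases p) auto
    moreover have "\<omega> z x = - ksign (d * e) * \<omega> x z"
    proof -
      have "\<forall>a b. \<forall>x\<in>part G a. \<forall>y\<in>part G b. \<omega> x y = - ksign (a * b) * \<omega> y x"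
        using sympG unfolding symplectic_def by (elim conjE)
      from this[rule_format, OF hom(2,1)] show ?thesis .
    qed
    ultimately show ?thesis by simp
  next
    case False
    then have "\<omega> z x = 0" using \<omega>_parity hom by blast
    moreover have "\<omega> x z = 0" using False \<omega>_parity hom by (metis add.commute)
    ultimately show ?thesis by simp
  qed
next
  case (add x y)
  then show ?case by (simp add: \<omega>_lin part_V algebra_simps)
qed

lemma nondegB:
  assumes "x \<in> V" "\<And>y. y \<in> V \<Longrightarrow> B x y = 0" shows "x = 0"
proof -
  have "nondegenerate G B" using quadG unfolding quadratic_def by (elim conjE)
  then show ?thesis using assms unfolding nondegenerate_def by blast
qed

lemma \<Delta>_superderivation: "superderivation s 1 G \<Delta>"
  using sder unfolding symplectic_derivation_def by (elim conjE)

lemma \<Delta>_linear_on: "linear_on s s V \<Delta>"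
  using \<Delta>_superderivation unfolding superderivation_def by (elim conjE)

lemma \<Delta>_lin:
  "x \<in> V \<Longrightarrow> y \<in> V \<Longrightarrow> \<Delta> (x + y) = \<Delta> x + \<Delta> y" "x \<in> V \<Longrightarrow> \<Delta> (s c x) = s c (\<Delta> x)"
  using \<Delta>_linear_on unfolding linear_on_def by blast+

lemma \<Delta>_part:
  assumes "x \<in> part G d" shows "\<Delta> x \<in> part G (d + 1)"
proof -
  have "\<forall>a. \<Delta> ` part G a \<subseteq> part G (a + 1)"
    using \<Delta>_superderivation unfolding superderivation_def by (elim conjE)
  then show ?thesis using assms by blast
qed

lemma \<Delta>_br:
  assumes "x \<in> part G d" "y \<in> V"
  shows "\<Delta> (br x y) = br (\<Delta> x) y + s (ksign d) (br x (\<Delta> y))"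
proof -
  have "\<forall>a. \<forall>x\<in>part G a. \<forall>y\<in>V. \<Delta> (br x y) = br (\<Delta> x) y + s (ksign (1 * a)) (br x (\<Delta> y))"
    using \<Delta>_superderivation unfolding superderivation_def by (elim conjE)
  from this[rule_format, OF assms] show ?thesis by (simp only: mult_1)
qed

lemma \<Delta>_bij: "bij_betw \<Delta> V V"
  using sder unfolding symplectic_derivation_def by (elim conjE)

lemma \<omega>_def: "x \<in> V \<Longrightarrow> y \<in> V \<Longrightarrow> \<omega> x y = B (\<Delta> x) y"
proof -
  have "\<forall>x\<in>V. \<forall>y\<in>V. \<omega> x y = B (\<Delta> x) y"
    using sder unfolding symplectic_derivation_def by (elim conjE)
  then show "x \<in> V \<Longrightarrow> y \<in> V \<Longrightarrow> \<omega> x y = B (\<Delta> x) y" by simp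
qed

lemma \<Delta>_V [simp]: "x \<in> V \<Longrightarrow> \<Delta> x \<in> V"
  by (rule bij_betw_apply[OF \<Delta>_bij])

lemma \<Delta>_zero [simp]: "\<Delta> 0 = 0"
  using \<Delta>_lin(1)[OF V_zero V_zero] by simp

lemma \<Delta>_inj: "x \<in> V \<Longrightarrow> \<Delta> x = 0 \<Longrightarrow> x = 0"
  by (rule inj_onD[OF bij_betw_imp_inj_on[OF \<Delta>_bij]]) simp_all

text \<open>Skew-supersymmetry of \<open>\<omega>\<close>, expressed through \<open>B\<close> and \<open>\<Delta>\<close>.\<close>

lemma \<Delta>_swap:
  assumes "z \<in> part G d" "x \<in> V"
  shows "B (\<Delta> z) x = - ksign (d * (p + 1 + d)) * B (\<Delta> x) z"
  using \<omega>_swap[OF assms]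
  unfolding \<omega>_def[OF part_V[OF assms(1)] assms(2)] \<omega>_def[OF assms(2) part_V[OF assms(1)]] .

lemma \<Delta>_skew:
  assumes "z \<in> part G d" "x \<in> V" shows "B (\<Delta> z) x = - ksign d * B z (\<Delta> x)"
proof -
  have "\<forall>a. \<forall>x\<in>part G a. \<forall>y\<in>V. B (\<Delta> x) y = - ksign (1 * a) * B x (\<Delta> y)"
    using sder unfolding symplectic_derivation_def skew_supersymmetric_def by (elim conjE)
  from this[rule_format, OF assms] show ?thesis by (simp only: mult_1)
qed

lemma isotropic:
  "x \<in> \<aa> \<Longrightarrow> y \<in> \<aa> \<Longrightarrow> B x y = 0" "x \<in> \<bb> \<Longrightarrow> y \<in> \<bb> \<Longrightarrow> B x y = 0"
proof -
  have "\<forall>x\<in>\<aa>. \<forall>y\<in>\<aa>. B x y = 0 \<and> \<omega> x y = 0"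
    using manin unfolding special_manin_def by (elim conjE)
  then show "x \<in> \<aa> \<Longrightarrow> y \<in> \<aa> \<Longrightarrow> B x y = 0" by simp
  have "\<forall>x\<in>\<bb>. \<forall>y\<in>\<bb>. B x y = 0 \<and> \<omega> x y = 0"
    using manin unfolding special_manin_def by (elim conjE)
  then show "x \<in> \<bb> \<Longrightarrow> y \<in> \<bb> \<Longrightarrow> B x y = 0" by simp
qed

lemma subspace_\<aa>: "subspace \<aa>"
  using sub\<aa> unfolding lie_subsuperalgebra_def by (elim conjE)

lemma subspace_\<bb>: "subspace \<bb>"
  using sub\<bb> unfolding lie_subsuperalgebra_def by (elim conjE)

lemma V_sum: "V = {x + y | x y. x \<in> \<aa> \<and> y \<in> \<bb>}"
  using manin unfolding special_manin_def by (elim conjE)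

lemma \<aa>_V: "x \<in> \<aa> \<Longrightarrow> x \<in> V"
  using subspace_0[OF subspace_\<bb>] unfolding V_sum by force

lemma \<bb>_V: "x \<in> \<bb> \<Longrightarrow> x \<in> V"
  using subspace_0[OF subspace_\<aa>] unfolding V_sum by force

lemma \<aa>_cases:
  assumes "x \<in> \<aa>"
  obtains x0 x1 where "x0 \<in> \<aa>" "x0 \<in> part G 0" "x1 \<in> \<aa>" "x1 \<in> part G 1" "x = x0 + x1"
proof -
  have "\<aa> = {x + y | x y. x \<in> \<aa> \<inter> part G 0 \<and> y \<in> \<aa> \<inter> part G 1}"
    using sub\<aa> unfolding lie_subsuperalgebra_def by (elim conjE)
  with assms have "x \<in> {x + y | x y. x \<in> \<aa> \<inter> part G 0 \<and> y \<in> \<aa> \<inter> part G 1}" by (rule back_subst)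
  then show ?thesis using that by blast
qed

lemma \<bb>_br:
  assumes "x \<in> \<bb>" "y \<in> \<bb>" shows "br x y \<in> \<bb>"
proof -
  have "\<forall>x\<in>\<bb>. \<forall>y\<in>\<bb>. br x y \<in> \<bb>" using sub\<bb> unfolding lie_subsuperalgebra_def by (elim conjE)
  then show ?thesis using assms by blast
qed

lemma \<bb>_cases:
  assumes "x \<in> \<bb>"
  obtains x0 x1 where "x0 \<in> \<bb>" "x0 \<in> part G 0" "x1 \<in> \<bb>" "x1 \<in> part G 1" "x = x0 + x1"
proof -
  have "\<bb> = {x + y | x y. x \<in> \<bb> \<inter> part G 0 \<and> y \<in> \<bb> \<inter> part G 1}"
    using sub\<bb> unfolding lie_subsuperalgebra_def by (elim conjE)
  with assms have "x \<in> {x + y | x y. x \<in> \<bb> \<inter> part G 0 \<and> y \<in> \<bb> \<inter> part G 1}" by (rule back_subst)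
  then show ?thesis using that by blast
qed

end

section \<open>The orthogonal complement of a hyperbolic pair of planes\<close>

text \<open>The central vectors \<open>u0\<close>, \<open>u1\<close> of \<open>\<aa>\<close> become \<open>e\<^sub>0\<^sup>*\<close>, \<open>e\<^sub>1\<^sup>*\<close> of the double extension, and the vectors
  \<open>e0\<close>, \<open>e1\<close> of \<open>\<bb>\<close> become \<open>e\<^sub>0\<close>, \<open>e\<^sub>1\<close>. An even form pairs vectors of equal degree, an odd form vectors of
  opposite degree; hence the exchange of the two dual vectors when the parity \<open>p\<close> is odd.\<close>

locale double_extension_frame = symplectic_manin +
  fixes u0 u1 e0 e1 :: 'b and l :: 'a
  assumes u0: "u0 \<in> \<aa>" "u0 \<in> part G 0" and u1: "u1 \<in> \<aa>" "u1 \<in> part G 1"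
    and central: "x \<in> scarrier G \<Longrightarrow> brk G u0 x = 0" "x \<in> scarrier G \<Longrightarrow> brk G u1 x = 0"
    and \<Delta>_u: "\<Delta> u0 = s l u1" "\<Delta> u1 = s l u0" and l: "l \<noteq> 0"
    and e0: "e0 \<in> \<bb>" "e0 \<in> part G 0" and e1: "e1 \<in> \<bb>" "e1 \<in> part G 1"
    and dual: "B u0 (if p = 0 then e0 else e1) = 1" "B u1 (if p = 0 then e1 else e0) = 1"
begin

text \<open>Indexing the vectors of \<open>\<bb>\<close> by the central vector to which they are dual, and not by their degree,
  makes the orthogonal projection the same for both parities.\<close>

definition w0 where "w0 = (if p = 0 then e0 else e1)"
definition w1 where "w1 = (if p = 0 then e1 else e0)"

lemma w0: "w0 \<in> \<bb>" "w0 \<in> part G p" and w1: "w1 \<in> \<bb>" "w1 \<in> part G (p + 1)"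
proof -
  have "p = 0 \<or> p = 1" using bit_not_zero_iff by blast
  then show "w0 \<in> \<bb>" "w0 \<in> part G p" "w1 \<in> \<bb>" "w1 \<in> part G (p + 1)"
    using e0 e1 by (auto simp: w0_def w1_def)
qed

lemma uw_V [simp]: "u0 \<in> V" "u1 \<in> V" "e0 \<in> V" "e1 \<in> V" "w0 \<in> V" "w1 \<in> V"
  using part_V[OF u0(2)] part_V[OF u1(2)] part_V[OF e0(2)] part_V[OF e1(2)]
    part_V[OF w0(2)] part_V[OF w1(2)] by simp_all

lemma B_uw [simp]: "B u0 w0 = 1" "B u1 w1 = 1" "B u0 w1 = 0" "B u1 w0 = 0"
proof -
  show "B u0 w0 = 1" "B u1 w1 = 1" using dual by (auto simp: w0_def w1_def)
  show "B u0 w1 = 0" "B u1 w0 = 0"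
    by (rule B_parity[OF _ u0(2) w1(2)], simp) (rule B_parity[OF _ u1(2) w0(2)], simp)
qed

lemma B_wu [simp]:
  "B w0 u0 = 1" "B w1 u1 = ksign (p + 1)" "B w1 u0 = 0" "B w0 u1 = 0"
proof -
  have "B u0 w0 = ksign (0 * (p + 0)) * B w0 u0" "B u0 w1 = ksign (0 * (p + 0)) * B w1 u0"
    by (rule B_swap; simp add: u0)+
  then show "B w0 u0 = 1" "B w1 u0 = 0" by simp_all
  have "B u1 w0 = ksign (p + 1) * B w0 u1" "B u1 w1 = ksign (p + 1) * B w1 u1"
    using B_swap[OF u1(2) uw_V(5)] B_swap[OF u1(2) uw_V(6)] by simp_all
  moreover from this have "ksign (p + 1) * (ksign (p + 1) * B w1 u1) = ksign (p + 1)" by simp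
  ultimately show "B w0 u1 = 0" "B w1 u1 = ksign (p + 1)" by (simp, simp only: ksign_simps)
qed

lemma B_uu [simp]:
  "B u0 u0 = 0" "B u0 u1 = 0" "B u1 u0 = 0" "B u1 u1 = 0"
  "B w0 w0 = 0" "B w0 w1 = 0" "B w1 w0 = 0" "B w1 w1 = 0"
  using isotropic u0 u1 w0 w1 by simp_all

lemma central_right: assumes "x \<in> V" shows "br x u0 = 0" "br x u1 = 0"
proof -
  show "br x u0 = 0" using br_skew0[OF u0(2) assms] central(1)[OF assms] by simp
  show "br x u1 = 0" using assms
  proof (induction x rule: homogeneous_induct)
    case (hom d x)
    then show ?case using br_skew[OF hom u1(2)] central(2)[of x] part_V by simp
  next
    case (add x y)
    then show ?case by (simp add: br_lin)
  qed
qed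

definition pr :: "'b \<Rightarrow> 'b" where
  "pr x = x - (s (B x w0) u0 + s (B x w1) u1 + s (B u0 x) w0 + s (B u1 x) w1)"

definition perp :: "'b set" where
  "perp = {x \<in> V. B x w0 = 0 \<and> B x w1 = 0 \<and> B u0 x = 0 \<and> B u1 x = 0}"

definition H :: "'b superalgebra" where
  "H = \<lparr>part = \<lambda>d. part G d \<inter> perp, brk = \<lambda>x y. pr (br x y)\<rparr>"

lemma H_sel [simp]: "part H d = part G d \<inter> perp" "brk H x y = pr (br x y)"
  by (simp_all add: H_def)

text \<open>The orthogonal of the central ideal spanned by \<open>u0\<close> and \<open>u1\<close>. It is a \<open>\<Delta>\<close>-stable ideal that contains
  all brackets, and its quotient by the central ideal is the reduced superalgebra.\<close>

definition K :: "'b set" where "K = {x \<in> V. B u0 x = 0 \<and> B u1 x = 0}"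

lemma perpD [simp]:
  "x \<in> perp \<Longrightarrow> x \<in> V" "x \<in> perp \<Longrightarrow> B x w0 = 0" "x \<in> perp \<Longrightarrow> B x w1 = 0"
  "x \<in> perp \<Longrightarrow> B u0 x = 0" "x \<in> perp \<Longrightarrow> B u1 x = 0"
  by (simp_all add: perp_def)

lemma perp_right [simp]:
  assumes "x \<in> perp"
  shows "B w0 x = 0" "B w1 x = 0" "B x u0 = 0" "B x u1 = 0"
  using B_eq_0_iff[OF w0(2)] B_eq_0_iff[OF w1(2)] B_eq_0_iff[OF u0(2)] B_eq_0_iff[OF u1(2)]
    perpD[OF assms] by blast+

lemma K_V: "x \<in> K \<Longrightarrow> x \<in> V" and perp_K: "x \<in> perp \<Longrightarrow> x \<in> K"
  by (simp_all add: K_def)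

lemma br_K [simp]: "x \<in> V \<Longrightarrow> y \<in> V \<Longrightarrow> br x y \<in> K"
  using B_inv[of u0 x y] B_inv[of u1 x y] by (simp add: K_def central)

lemma B_u\<Delta>:
  assumes "x \<in> V" shows "B u0 (\<Delta> x) = - l * B u1 x" "B u1 (\<Delta> x) = l * B u0 x"
  using \<Delta>_skew[OF u0(2) assms] \<Delta>_skew[OF u1(2) assms] assms by (simp_all add: \<Delta>_u B_lin)

lemma \<Delta>_K [simp]: "x \<in> K \<Longrightarrow> \<Delta> x \<in> K"
  by (simp add: K_def B_u\<Delta>)

lemma pr_V [simp]: "x \<in> V \<Longrightarrow> pr x \<in> V"
  by (simp add: pr_def V_cl)

lemma pr_perp [simp]: assumes "x \<in> V" shows "pr x \<in> perp"
  using assms by (simp add: perp_def pr_def B_lin B_diff V_cl del: perpD perp_right)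

lemma pr_id [simp]: "x \<in> perp \<Longrightarrow> pr x = x"
  by (simp add: pr_def)

lemma pr_lin:
  "x \<in> V \<Longrightarrow> y \<in> V \<Longrightarrow> pr (x + y) = pr x + pr y" "x \<in> V \<Longrightarrow> pr (s c x) = s c (pr x)"
  "x \<in> V \<Longrightarrow> y \<in> V \<Longrightarrow> pr (x - y) = pr x - pr y" "x \<in> V \<Longrightarrow> pr (- x) = - pr x"
proof -
  show "x \<in> V \<Longrightarrow> y \<in> V \<Longrightarrow> pr (x + y) = pr x + pr y"
    by (simp add: pr_def B_lin scale_left_distrib)
  show sc: "x \<in> V \<Longrightarrow> pr (s c x) = s c (pr x)" for c x
    by (simp add: pr_def B_lin scale_right_distrib scale_right_diff_distrib)
  show "x \<in> V \<Longrightarrow> y \<in> V \<Longrightarrow> pr (x - y) = pr x - pr y"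
    by (simp add: pr_def B_diff scale_left_diff_distrib)
  show "x \<in> V \<Longrightarrow> pr (- x) = - pr x" using sc[of x "-1"] by simp
qed

lemma pr_split:
  assumes "x \<in> perp" "x = y + z" "y \<in> V" "z \<in> V" shows "x = pr y + pr z"
  using pr_id[OF assms(1)] pr_lin(1)[OF assms(3,4)] assms(2) by simp

lemma pr_u [simp]: "pr u0 = 0" "pr u1 = 0"
  by (simp_all add: pr_def)

lemma pr_zero [simp]: "pr 0 = 0"
  by (simp add: pr_def)

lemma pr_part: assumes "x \<in> part G d" shows "pr x \<in> part G d"
proof -
  have scal: "s c z \<in> part G d" if "z \<in> part G e" "e \<noteq> d \<Longrightarrow> c = 0" for c z e
    using that subspace_scale[OF subspace_part] subspace_0[OF subspace_part] by (cases "e = d") auto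
  have 1: "s (B x w0) u0 \<in> part G d"
    by (rule scal[OF u0(2)], rule B_parity[OF _ assms w0(2)]) (cases "p = 0"; simp)
  have 2: "s (B x w1) u1 \<in> part G d"
    by (rule scal[OF u1(2)], rule B_parity[OF _ assms w1(2)]) (cases "p = 0"; simp)
  have 3: "s (B u0 x) w0 \<in> part G d"
    by (rule scal[OF w0(2)], rule B_parity[OF _ u0(2) assms]) (cases "p = 0"; cases "d = 0"; simp)
  have 4: "s (B u1 x) w1 \<in> part G d"
    by (rule scal[OF w1(2)], rule B_parity[OF _ u1(2) assms]) (cases "p = 0"; cases "d = 0"; simp)
  show ?thesis unfolding pr_def
    using 1 2 3 4 assms by (intro subspace_diff subspace_add subspace_part)
qed

lemma pr_K: "x \<in> K \<Longrightarrow> pr x = x - (s (B x w0) u0 + s (B x w1) u1)"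
  by (simp add: pr_def K_def)

text \<open>On the orthogonal of the central ideal, \<open>pr\<close> only removes central elements, which are
  invisible to brackets, and which \<open>\<Delta>\<close> maps to central elements again.\<close>

lemma br_pr [simp]:
  assumes "x \<in> V" "y \<in> K" shows "br x (pr y) = br x y" "br (pr y) x = br y x"
proof -
  let ?z = "s (B y w0) u0 + s (B y w1) u1"
  have y: "y \<in> V" and eq: "y = pr y + ?z" using K_V assms(2) pr_K[OF assms(2)] by simp_all
  have z: "?z \<in> V" by (simp add: V_cl)
  have "br x y = br x (pr y) + br x ?z" "br y x = br (pr y) x + br ?z x"
    using br_lin(1,2)[of "pr y" ?z x] assms(1) y z eq by simp_all
  then show "br x (pr y) = br x y" "br (pr y) x = br y x"
    using assms(1) by (simp_all add: br_lin central central_right V_cl)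
qed

lemma pr_\<Delta>_pr [simp]: assumes "x \<in> K" shows "pr (\<Delta> (pr x)) = pr (\<Delta> x)"
proof -
  let ?z = "s (B x w0) u0 + s (B x w1) u1"
  have x: "x \<in> V" and eq: "x = pr x + ?z" using K_V assms pr_K[OF assms] by simp_all
  have z: "?z \<in> V" by (simp add: V_cl)
  have "pr (\<Delta> x) = pr (\<Delta> (pr x)) + pr (\<Delta> ?z)"
    using \<Delta>_lin(1)[of "pr x" ?z] x z eq by (simp add: pr_lin)
  also have "pr (\<Delta> ?z) = 0" by (simp add: \<Delta>_lin \<Delta>_u pr_lin V_cl)
  finally show ?thesis by simp
qed

lemma B_pr [simp]:
  assumes "x \<in> V" "y \<in> perp" shows "B (pr x) y = B x y" "B y (pr x) = B y x"
  using assms by (simp_all add: pr_def B_lin B_diff V_cl)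

lemma subspace_perp: "subspace perp"
  unfolding subspace_def by (auto simp: perp_def B_lin V_cl simp del: perpD perp_right)

lemma perp_cl:
  "x \<in> perp \<Longrightarrow> y \<in> perp \<Longrightarrow> x + y \<in> perp" "x \<in> perp \<Longrightarrow> s c x \<in> perp"
  using subspace_perp subspace_add subspace_scale by blast+

lemma scarrier_H [simp]: "scarrier H = perp"
proof
  show "scarrier H \<subseteq> perp" unfolding scarrier_def using perp_cl by auto
  show "perp \<subseteq> scarrier H"
  proof
    fix x assume x: "x \<in> perp"
    then obtain x0 x1 where *: "x0 \<in> part G 0" "x1 \<in> part G 1" "x = x0 + x1"
      using V_cases perpD(1) by blast
    then have "x = pr x0 + pr x1" using pr_split[OF x] part_V by blast
    moreover have "pr x0 \<in> part H 0" "pr x1 \<in> part H 1" using * pr_part part_V by auto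
    ultimately show "x \<in> scarrier H" unfolding scarrier_def by blast
  qed
qed

section \<open>The reduced superalgebra\<close>

lemma linear_pr_comp:
  "linear_on s s V f \<Longrightarrow> (\<And>x. x \<in> V \<Longrightarrow> f x \<in> V) \<Longrightarrow> linear_on s s perp (\<lambda>x. pr (f x))"
  unfolding linear_on_def by (simp add: pr_lin)

lemma linear_perp: "linear_on s s' V f \<Longrightarrow> linear_on s s' perp f"
  unfolding linear_on_def by simp

lemma br_linear: "x \<in> V \<Longrightarrow> linear_on s s V (br x)" "x \<in> V \<Longrightarrow> linear_on s s V (\<lambda>y. br y x)"
  using br_bil unfolding bilinear_on_def by blast+

text \<open>Each Lie identity is the projection of the same identity in \<open>G\<close>: projecting an inner bracket does
  not change an outer one.\<close>

lemma lie_H: "lie_superalgebra s H"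
  unfolding lie_superalgebra_def
proof (intro conjI allI ballI)
  show "subspace (part H d)" for d
    by (simp add: subspace_inter subspace_part subspace_perp)
  have "part G 0 \<inter> part G 1 = {0}"
    using lieG unfolding lie_superalgebra_def by (elim conjE)
  then show "part H 0 \<inter> part H 1 = {0}" using subspace_0[OF subspace_perp] by auto
  obtain S where "finite S" "span S = V"
    using lieG unfolding lie_superalgebra_def by (elim conjE exE)
  then show "\<exists>S. finite S \<and> span S = scarrier H"
    using subspace_finitely_spanned[OF subspace_perp, of S] perpD(1) by (metis scarrier_H subsetI)
  have "brk H = (\<lambda>x y. pr (br x y))" by (simp add: H_def)
  then show "bilinear_on s s (scarrier H) (brk H)"
    unfolding bilinear_on_def by (auto intro!: linear_pr_comp br_linear)
next
  fix a b x y assume "x \<in> part H a" "y \<in> part H b"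
  then have x: "x \<in> part G a" "x \<in> perp" and y: "y \<in> part G b" "y \<in> perp" by auto
  show "brk H x y \<in> part H (a + b)" using x y pr_part br_part by auto
  have "pr (br x y) = pr (- s (ksign (a * b)) (br y x))" using br_skew[OF x(1) y(1)] by simp
  then show "brk H x y = - s (ksign (a * b)) (brk H y x)"
    using x(2) y(2) by (simp add: pr_lin V_cl)
next
  fix a b c x y z assume "x \<in> part H a" "y \<in> part H b" "z \<in> part H c"
  then have x: "x \<in> part G a" "x \<in> perp" and y: "y \<in> part G b" "y \<in> perp" and z: "z \<in> perp" by auto
  have "pr (br x (br y z)) = pr (br (br x y) z + s (ksign (a * b)) (br y (br x z)))"
    using jacobi[OF x(1) y(1)] z by simp
  then show "brk H x (brk H y z) = brk H (brk H x y) z + s (ksign (a * b)) (brk H y (brk H x z))"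
    using x(2) y(2) z by (simp add: pr_lin V_cl)
qed

lemma form_parity_H: "form_parity G q f \<Longrightarrow> form_parity H q f"
  unfolding form_parity_def by simp

lemma bilinear_H: "bilinear_on s s' V f \<Longrightarrow> bilinear_on s s' perp f"
  unfolding bilinear_on_def by (simp add: linear_perp)

text \<open>Non-degeneracy descends because \<open>pr\<close> does not change the pairing with a vector orthogonal to
  \<open>u0\<close>, \<open>u1\<close>, \<open>w0\<close>, \<open>w1\<close>.\<close>

lemma quadratic_H: "quadratic s p H B"
  unfolding quadratic_def
proof (intro conjI allI ballI)
  show "bilinear_on s (*) (scarrier H) B" using bilinear_H[OF B_bil] by simp
  have "form_parity G p B" using quadG unfolding quadratic_def by (elim conjE)
  then show "form_parity H p B" by (rule form_parity_H)
  have sym: "\<forall>a b. \<forall>x\<in>part G a. \<forall>y\<in>part G b. B x y = ksign (a * b) * B y x"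
    using quadG unfolding quadratic_def by (elim conjE)
  fix a b x y assume "x \<in> part H a" "y \<in> part H b"
  then show "B x y = ksign (a * b) * B y x" using sym[rule_format, of x a y b] by simp
next
  fix x y z assume "x \<in> scarrier H" "y \<in> scarrier H" "z \<in> scarrier H"
  then show "B (brk H x y) z = B x (brk H y z)" by (simp add: B_inv)
next
  show "nondegenerate H B"
    unfolding nondegenerate_def
  proof (intro ballI impI)
    fix x assume x: "x \<in> scarrier H" and 0: "\<forall>y\<in>scarrier H. B x y = 0"
    have "B x y = 0" if "y \<in> V" for y
    proof -
      have "B x y = B x (pr y)" using x that by simp
      also have "\<dots> = 0" using 0 that by (simp del: B_pr)
      finally show ?thesis .
    qed
    then show "x = 0" using nondegB x by simp
  qed
qed

abbreviation \<delta> where "\<delta> x \<equiv> pr (\<Delta> x)"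

lemma \<delta>_inj: assumes "x \<in> perp" "\<delta> x = 0" shows "x = 0"
proof -
  \<comment> \<open>\<open>\<Delta> x\<close> lies in the span of \<open>u0\<close> and \<open>u1\<close>, which is the image under \<open>\<Delta>\<close> of itself.\<close>
  define y where "y = s (B (\<Delta> x) w0 / l) u1 + s (B (\<Delta> x) w1 / l) u0"
  have y: "y \<in> V" by (simp add: y_def V_cl)
  have "\<Delta> x - (s (B (\<Delta> x) w0) u0 + s (B (\<Delta> x) w1) u1) = 0"
    using pr_K[OF \<Delta>_K[OF perp_K[OF assms(1)]]] unfolding assms(2) by (rule sym)
  then have "\<Delta> x = s (B (\<Delta> x) w0) u0 + s (B (\<Delta> x) w1) u1"
    by (rule iffD2[OF eq_iff_diff_eq_0])
  also have "\<dots> = \<Delta> y" using l by (simp add: y_def \<Delta>_lin \<Delta>_u V_cl)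
  finally have "x = y"
    by (rule inj_onD[OF bij_betw_imp_inj_on[OF \<Delta>_bij] _ perpD(1)[OF assms(1)] y])
  moreover have "pr y = 0" unfolding y_def by (simp add: pr_lin V_cl)
  ultimately show ?thesis using pr_id[OF assms(1)] by metis
qed

lemma \<delta>_surj: assumes "y \<in> perp" shows "\<exists>x\<in>perp. \<delta> x = y"
proof -
  have "y \<in> \<Delta> ` V" unfolding bij_betw_imp_surj_on[OF \<Delta>_bij] using assms by simp
  then obtain x where x: "x \<in> V" "\<Delta> x = y" by auto
  have "l * B u1 x = 0" "l * B u0 x = 0" using B_u\<Delta>[OF x(1)] x(2) assms by simp_all
  then have "x \<in> K" using l x(1) by (simp add: K_def)
  then have "\<delta> (pr x) = y" using x(2) assms by simp
  then show ?thesis using pr_perp[OF x(1)] by (rule bexI)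
qed

lemma superderivation_\<delta>: "superderivation s 1 H \<delta>"
  unfolding superderivation_def
proof (intro conjI allI ballI subsetI)
  show "linear_on s s (scarrier H) \<delta>" using linear_pr_comp[OF \<Delta>_linear_on] by simp
  show "y \<in> part H (a + 1)" if "y \<in> \<delta> ` part H a" for a y
  proof -
    from that obtain x where x: "x \<in> part G a" "x \<in> perp" "y = \<delta> x" by auto
    then show ?thesis using pr_part[OF \<Delta>_part[OF x(1)]] by simp
  qed
  fix a x y assume "x \<in> part H a" "y \<in> scarrier H"
  then have x: "x \<in> part G a" "x \<in> perp" and y: "y \<in> perp" by auto
  have "pr (\<Delta> (br x y)) = pr (br (\<Delta> x) y + s (ksign a) (br x (\<Delta> y)))"
    using \<Delta>_br[OF x(1)] y by simp
  then show "\<delta> (brk H x y) = brk H (\<delta> x) y + s (ksign (1 * a)) (brk H x (\<delta> y))"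
    using x(2) y perp_K by (simp add: pr_lin V_cl)
qed

lemma symplectic_derivation_H: "symplectic_derivation s H B \<omega> \<delta>"
  unfolding symplectic_derivation_def
proof (intro conjI ballI)
  show "superderivation s 1 H \<delta>" by (rule superderivation_\<delta>)
  show "skew_supersymmetric 1 H B \<delta>"
    unfolding skew_supersymmetric_def
  proof (intro allI ballI)
    fix a x y assume "x \<in> part H a" "y \<in> scarrier H"
    then show "B (\<delta> x) y = - ksign (1 * a) * B x (\<delta> y)" using \<Delta>_skew[of x a y] by simp
  qed
  have "inj_on \<delta> perp"
  proof (rule inj_onI)
    fix x y assume *: "x \<in> perp" "y \<in> perp" "\<delta> x = \<delta> y"
    have "\<Delta> x = \<Delta> (x - y) + \<Delta> y" using \<Delta>_lin(1)[of "x - y" y] * V_cl(3) by simp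
    then have "\<delta> (x - y) = 0" using * pr_lin(1)[of "\<Delta> (x - y)" "\<Delta> y"] V_cl(3) by simp
    moreover have "x - y \<in> perp" using subspace_diff[OF subspace_perp *(1,2)] .
    ultimately have "x - y = 0" by (rule \<delta>_inj[rotated])
    then show "x = y" by simp
  qed
  moreover have "\<delta> ` perp = perp"
  proof
    show "\<delta> ` perp \<subseteq> perp" by (rule image_subsetI) simp
    show "perp \<subseteq> \<delta> ` perp"
    proof
      fix y assume "y \<in> perp"
      then obtain x where "x \<in> perp" "\<delta> x = y" using \<delta>_surj by meson
      then show "y \<in> \<delta> ` perp" by (rule rev_image_eqI[OF _ sym])
    qed
  qed
  ultimately show "bij_betw \<delta> (scarrier H) (scarrier H)" by (simp add: bij_betw_def)
  show "\<omega> x y = B (\<delta> x) y" if "x \<in> scarrier H" "y \<in> scarrier H" for x y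
    using that by (simp add: \<omega>_def)
qed

text \<open>The central plane is \<open>\<omega>\<close>-orthogonal to the complement since \<open>\<Delta>\<close> preserves it. This gives the cyclic
  identity of \<open>\<omega>\<close> for the projected bracket; non-degeneracy needs the injectivity of \<open>\<delta>\<close> instead,
  because \<open>w0\<close> and \<open>w1\<close> are in general not \<open>\<omega>\<close>-orthogonal to the complement.\<close>

lemma \<omega>_pr: assumes "x \<in> perp" "y \<in> K" shows "\<omega> x (pr y) = \<omega> x y"
proof -
  have "B (\<Delta> x) u0 = 0" "B (\<Delta> x) u1 = 0"
    using B_eq_0_iff[OF u0(2), of "\<Delta> x"] B_eq_0_iff[OF u1(2), of "\<Delta> x"] assms(1)
    by (simp_all add: B_u\<Delta>)
  then show ?thesis
    using assms K_V[OF assms(2)] by (simp add: \<omega>_def pr_K B_lin B_diff V_cl)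
qed

lemma symplectic_H: "symplectic s (p + 1) H \<omega>"
  unfolding symplectic_def
proof (intro conjI allI ballI)
  show "bilinear_on s (*) (scarrier H) \<omega>" using bilinear_H[OF \<omega>_bil] by simp
  have "form_parity G (p + 1) \<omega>" using sympG unfolding symplectic_def by (elim conjE)
  then show "form_parity H (p + 1) \<omega>" by (rule form_parity_H)
  have sym: "\<forall>a b. \<forall>x\<in>part G a. \<forall>y\<in>part G b. \<omega> x y = - ksign (a * b) * \<omega> y x"
    using sympG unfolding symplectic_def by (elim conjE)
  fix a b x y assume "x \<in> part H a" "y \<in> part H b"
  then show "\<omega> x y = - ksign (a * b) * \<omega> y x" using sym[rule_format, of x a y b] by simp
next
  have cyc: "\<forall>a b c. \<forall>x\<in>part G a. \<forall>y\<in>part G b. \<forall>z\<in>part G c.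
       ksign (c * a) * \<omega> x (br y z) + ksign (a * b) * \<omega> y (br z x)
         + ksign (b * c) * \<omega> z (br x y) = 0"
    using sympG unfolding symplectic_def by (elim conjE)
  fix a b c x y z assume "x \<in> part H a" "y \<in> part H b" "z \<in> part H c"
  then show "ksign (c * a) * \<omega> x (brk H y z) + ksign (a * b) * \<omega> y (brk H z x)
         + ksign (b * c) * \<omega> z (brk H x y) = 0"
    using cyc[rule_format, of x a y b z c] by (simp add: \<omega>_pr)
next
  show "nondegenerate H \<omega>"
    unfolding nondegenerate_def
  proof (intro ballI impI)
    fix x assume x: "x \<in> scarrier H" and 0: "\<forall>y\<in>scarrier H. \<omega> x y = 0"
    have "B (\<delta> x) y = 0" if "y \<in> V" for y
    proof -
      have "B (\<delta> x) y = B (\<delta> x) (pr y)"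
        by (rule B_pr(2)[OF that, symmetric]) (use x in simp)
      also have "\<dots> = B (\<Delta> x) (pr y)" by (rule B_pr(1)) (use x that in simp_all)
      also have "\<dots> = 0" using 0 x that by (simp del: B_pr add: \<omega>_def)
      finally show ?thesis .
    qed
    then have "\<delta> x = 0" using nondegB x by simp
    then show "x = 0" by (rule \<delta>_inj[rotated]) (use x in simp)
  qed
qed

text \<open>On \<open>\<aa>\<close> the projection subtracts multiples of \<open>u0\<close>, \<open>u1\<close> only, on \<open>\<bb>\<close> multiples of \<open>w0\<close>, \<open>w1\<close>
  only, by isotropy; so it respects the Manin decomposition.\<close>

lemma pr_\<aa>: "x \<in> \<aa> \<Longrightarrow> pr x \<in> \<aa>"
  using u0(1) u1(1) isotropic(1) subspace_\<aa>
  by (simp add: pr_def subspace_add subspace_diff subspace_scale)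

lemma pr_\<bb>: "x \<in> \<bb> \<Longrightarrow> pr x \<in> \<bb>"
  using w0(1) w1(1) isotropic(2) subspace_\<bb>
  by (simp add: pr_def subspace_add subspace_diff subspace_scale)

lemma subsuperalgebra_H:
  assumes C: "lie_subsuperalgebra s G C" "C \<subseteq> V" and pr: "\<And>x. x \<in> C \<Longrightarrow> pr x \<in> C"
  shows "lie_subsuperalgebra s H (C \<inter> perp)"
  unfolding lie_subsuperalgebra_def
proof (intro conjI ballI)
  have sub: "subspace C" using C(1) unfolding lie_subsuperalgebra_def by (elim conjE)
  then show "subspace (C \<inter> perp)" using subspace_inter subspace_perp by blast
  have gr: "C = {x + y |x y. x \<in> C \<inter> part G 0 \<and> y \<in> C \<inter> part G 1}"
    using C(1) unfolding lie_subsuperalgebra_def by (elim conjE)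
  show "C \<inter> perp = {x + y |x y. x \<in> C \<inter> perp \<inter> part H 0 \<and> y \<in> C \<inter> perp \<inter> part H 1}" (is "_ = ?R")
  proof
    show "C \<inter> perp \<subseteq> ?R"
    proof
      fix x assume x: "x \<in> C \<inter> perp"
      then have "x \<in> {x + y |x y. x \<in> C \<inter> part G 0 \<and> y \<in> C \<inter> part G 1}" using gr by (metis IntD1)
      then obtain x0 x1 where *: "x0 \<in> C" "x0 \<in> part G 0" "x1 \<in> C" "x1 \<in> part G 1" "x = x0 + x1"
        by blast
      then have "x = pr x0 + pr x1" using pr_split[of x] x part_V by blast
      moreover have "pr x0 \<in> C \<inter> perp \<inter> part H 0" "pr x1 \<in> C \<inter> perp \<inter> part H 1"
        using * pr pr_part part_V by auto
      ultimately show "x \<in> ?R" by blast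
    qed
    show "?R \<subseteq> C \<inter> perp" using subspace_add[OF sub] perp_cl(1) by auto
  qed
  have br: "\<forall>x\<in>C. \<forall>y\<in>C. br x y \<in> C" using C(1) unfolding lie_subsuperalgebra_def by (elim conjE)
  fix x y assume "x \<in> C \<inter> perp" "y \<in> C \<inter> perp"
  then show "brk H x y \<in> C \<inter> perp" using br pr by simp
qed

lemma special_manin_H: "special_manin s p H (\<aa> \<inter> perp) (\<bb> \<inter> perp) B \<omega>"
  unfolding special_manin_def
proof (intro conjI)
  show "lie_superalgebra s H" by (rule lie_H)
  show "lie_subsuperalgebra s H (\<aa> \<inter> perp)"
    using subsuperalgebra_H[OF sub\<aa>] \<aa>_V pr_\<aa> by blast
  show "lie_subsuperalgebra s H (\<bb> \<inter> perp)"
    using subsuperalgebra_H[OF sub\<bb>] \<bb>_V pr_\<bb> by blast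
  have "\<aa> \<inter> \<bb> = {0}" using manin unfolding special_manin_def by (elim conjE)
  then show "\<aa> \<inter> perp \<inter> (\<bb> \<inter> perp) = {0}" using subspace_0[OF subspace_perp] by blast
  show "scarrier H = {x + y |x y. x \<in> \<aa> \<inter> perp \<and> y \<in> \<bb> \<inter> perp}" (is "_ = ?R")
  proof
    show "scarrier H \<subseteq> ?R"
    proof
      fix x assume "x \<in> scarrier H"
      then have x: "x \<in> perp" by simp
      then have "x \<in> {x + y |x y. x \<in> \<aa> \<and> y \<in> \<bb>}" using V_sum perpD(1) by metis
      then obtain y z where *: "y \<in> \<aa>" "z \<in> \<bb>" "x = y + z" by blast
      then have "x = pr y + pr z" using pr_split[OF x] \<aa>_V \<bb>_V by blast
      then show "x \<in> ?R" using * pr_\<aa> pr_\<bb> pr_perp \<aa>_V \<bb>_V by blast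
    qed
    show "?R \<subseteq> scarrier H" using perp_cl(1) by auto
  qed
  show "quadratic s p H B" by (rule quadratic_H)
  show "symplectic s (p + 1) H \<omega>" by (rule symplectic_H)
  have "\<forall>x\<in>\<aa>. \<forall>y\<in>\<aa>. B x y = 0 \<and> \<omega> x y = 0"
    using manin unfolding special_manin_def by (elim conjE)
  then show "\<forall>x\<in>\<aa> \<inter> perp. \<forall>y\<in>\<aa> \<inter> perp. B x y = 0 \<and> \<omega> x y = 0" by simp
  have "\<forall>x\<in>\<bb>. \<forall>y\<in>\<bb>. B x y = 0 \<and> \<omega> x y = 0"
    using manin unfolding special_manin_def by (elim conjE)
  then show "\<forall>x\<in>\<bb> \<inter> perp. \<forall>y\<in>\<bb> \<inter> perp. B x y = 0 \<and> \<omega> x y = 0" by simp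
qed

section \<open>The extension data\<close>

lemma self_neg_zero: "x = - x \<Longrightarrow> x = 0" for x :: 'b
proof -
  assume "x = - x"
  then have "s 2 x = 0"
    using scale_left_distrib[of 1 1 x] by (metis add.right_inverse one_add_one scale_one)
  then show "x = 0" by simp
qed

lemma scale_two: "s 2 x = x + x"
  using scale_left_distrib[of 1 1 x] by simp

lemma scale_half: "s (1 / 2) (x + x) = x"
  using scale_left_distrib[of "1 / 2" "1 / 2" x] by (simp add: scale_right_distrib)

text \<open>The maps \<open>D\<close> and \<open>Dbar\<close> of the extension data are the projections of the adjoint actions of
  \<open>e0\<close> and \<open>e1\<close>.\<close>

lemma superderivation_ad:
  assumes e: "e \<in> part G d" shows "superderivation s d H (\<lambda>x. pr (br e x))"
  unfolding superderivation_def
proof (intro conjI allI ballI subsetI)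
  have eV: "e \<in> V" using part_V[OF e] .
  show "linear_on s s (scarrier H) (\<lambda>x. pr (br e x))"
    using linear_pr_comp[OF br_linear(1)[OF eV]] eV by simp
  show "y \<in> part H (a + d)" if "y \<in> (\<lambda>x. pr (br e x)) ` part H a" for a y
  proof -
    from that obtain x where x: "x \<in> part G a" "x \<in> perp" "y = pr (br e x)" by auto
    then show ?thesis using pr_part[OF br_part[OF e x(1)]] eV unfolding add.commute[of d a] by simp
  qed
  fix a x y assume "x \<in> part H a" "y \<in> scarrier H"
  then have x: "x \<in> part G a" "x \<in> perp" and y: "y \<in> perp" by auto
  have "pr (br e (br x y)) = pr (br (br e x) y + s (ksign (d * a)) (br x (br e y)))"
    using jacobi[OF e x(1)] y by simp
  then show "pr (br e (brk H x y)) =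
      brk H (pr (br e x)) y + s (ksign (d * a)) (brk H x (pr (br e y)))"
    using x(2) y eV by (simp add: pr_lin V_cl)
qed

lemma skew_supersymmetric_ad:
  assumes e: "e \<in> part G d" shows "skew_supersymmetric d H B (\<lambda>x. pr (br e x))"
  unfolding skew_supersymmetric_def
proof (intro allI ballI)
  have eV: "e \<in> V" using part_V[OF e] .
  fix a x y assume "x \<in> part H a" "y \<in> scarrier H"
  then have x: "x \<in> part G a" "x \<in> perp" and y: "y \<in> perp" by auto
  have "B (br e x) y = B (- s (ksign (d * a)) (br x e)) y" using br_skew[OF e x(1)] by simp
  also have "\<dots> = - ksign (d * a) * B x (br e y)"
    using eV x y B_inv[of x e y] V_cl(2) by (simp add: B_lin B_neg)
  finally show "B (pr (br e x)) y = - ksign (d * a) * B x (pr (br e y))"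
    using eV x(2) y by simp
qed

definition x0 where "x0 = pr (br e1 e1)"
definition x1 where "x1 = pr (br e0 e1)"
definition c0 where "c0 = pr (\<Delta> e1)"
definition c1 where "c1 = pr (\<Delta> e0)"

lemma data_part: "x0 \<in> part H 0" "x1 \<in> part H 1" "c0 \<in> part H 0" "c1 \<in> part H 1"
  using pr_part[OF br_part[OF e1(2) e1(2)]] pr_part[OF br_part[OF e0(2) e1(2)]]
    pr_part[OF \<Delta>_part[OF e0(2)]] pr_part[OF \<Delta>_part[OF e1(2)]]
  by (simp_all add: x0_def x1_def c0_def c1_def)

lemma data_perp [simp]: "x0 \<in> perp" "x1 \<in> perp" "c0 \<in> perp" "c1 \<in> perp"
  using data_part by simp_all

text \<open>As \<open>\<bb>\<close> is a \<open>\<Delta>\<close>-stable subsuperalgebra, the data taken from \<open>e0\<close> and \<open>e1\<close> lie in \<open>\<bb>\<close>. Isotropy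
  then yields all scalar conditions on them and forces \<open>k = 0\<close> and \<open>\<alpha> = 0\<close>.\<close>

lemma e_stable_\<bb>: "br e0 e1 \<in> \<bb>" "br e1 e1 \<in> \<bb>" "\<Delta> e0 \<in> \<bb>" "\<Delta> e1 \<in> \<bb>"
  using \<bb>_br e0(1) e1(1) \<Delta>_\<bb> by blast+

lemma data_\<bb>: "x0 \<in> \<bb>" "x1 \<in> \<bb>" "c0 \<in> \<bb>" "c1 \<in> \<bb>"
  using pr_\<bb> e_stable_\<bb> by (simp_all add: x0_def x1_def c0_def c1_def)

text \<open>The coefficient of \<open>e1\<close> in \<open>\<Delta> e0\<close>. In terms of it the relations between the data read the same in
  both parities, so each is proved once; substituting \<open>l\<close> or \<open>- l\<close> produces the two lists of
  conditions in the definitions of the extension data.\<close>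

definition mu where "mu = (if p = 0 then l else - l)"

lemma \<bb>_decomp: assumes "x \<in> \<bb>" shows "x = pr x + s (B u0 x) w0 + s (B u1 x) w1"
proof -
  have "pr x = x - (s (B u0 x) w0 + s (B u1 x) w1)"
    using isotropic(2)[OF assms w0(1)] isotropic(2)[OF assms w1(1)] by (simp add: pr_def)
  then show ?thesis by (simp add: algebra_simps)
qed

lemma \<Delta>_e: "\<Delta> e0 = c1 + s mu e1" "\<Delta> e1 = c0 - s mu e0"
proof -
  have 0: "\<Delta> e0 = c1 + s (- l * B u1 e0) w0 + s (l * B u0 e0) w1"
    using \<bb>_decomp[OF e_stable_\<bb>(3)] unfolding B_u\<Delta>[OF uw_V(3)] c1_def .
  have 1: "\<Delta> e1 = c0 + s (- l * B u1 e1) w0 + s (l * B u0 e1) w1"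
    using \<bb>_decomp[OF e_stable_\<bb>(4)] unfolding B_u\<Delta>[OF uw_V(4)] c0_def .
  have "p = 0 \<Longrightarrow> B u0 e0 = 1 \<and> B u0 e1 = 0 \<and> B u1 e0 = 0 \<and> B u1 e1 = 1"
    "p \<noteq> 0 \<Longrightarrow> B u0 e1 = 1 \<and> B u0 e0 = 0 \<and> B u1 e1 = 0 \<and> B u1 e0 = 1"
    using B_uw unfolding w0_def w1_def by presburger+
  then show "\<Delta> e0 = c1 + s mu e1" "\<Delta> e1 = c0 - s mu e0"
    unfolding 0 1 by (simp_all add: mu_def w0_def w1_def)
qed

lemma data_br:
  assumes "x \<in> V"
  shows "br x x0 = br x (br e1 e1)" "br x x1 = br x (br e0 e1)"
    "br x0 x = br (br e1 e1) x" "br x1 x = br (br e0 e1) x"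
  using assms by (simp_all add: x0_def x1_def)

lemma data_\<delta>: "\<delta> x0 = \<delta> (br e1 e1)" "\<delta> x1 = \<delta> (br e0 e1)"
  by (simp_all add: x0_def x1_def)

text \<open>Every relation below is the projection of a Jacobi identity or of the derivation rule of \<open>\<Delta>\<close>, with
  \<open>e0\<close> and \<open>e1\<close> among the arguments. Here the Jacobi identity of the odd element \<open>e1\<close> with itself
  gives twice the square of its adjoint action.\<close>

lemma Dbar_square:
  assumes "X \<in> perp" shows "pr (br e1 (pr (br e1 X))) = s (1 / 2) (pr (br x0 X))"
proof -
  let ?y = "br e1 (br e1 X)"
  have "?y = br (br e1 e1) X - ?y" using jacobi[OF e1(2) e1(2), of X] assms by simp
  then have "br (br e1 e1) X = ?y + ?y" by (metis diff_add_cancel)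
  then have "pr (br x0 X) = pr ?y + pr ?y" using assms by (simp add: data_br pr_lin)
  then show ?thesis using assms by (simp add: scale_half)
qed

lemma Dbar_x0: "pr (br e1 x0) = 0"
proof -
  let ?y = "br e1 (br e1 e1)"
  have "br (br e1 e1) e1 = - ?y"
    using br_skew0[of "br e1 e1" e1] br_part[OF e1(2) e1(2)] by simp
  then have eq: "?y = - ?y - ?y" using jacobi[OF e1(2) e1(2), of e1] by simp
  have "s 3 ?y = ?y + (?y + ?y)" using scale_left_distrib[of 1 2 ?y] by (simp add: scale_two)
  also have "\<dots> = 0" by (subst (1) eq) simp
  finally have "?y = 0" by simp
  then show ?thesis by (simp add: data_br)
qed

lemma D_Dbar:
  assumes "X \<in> perp"
  shows "pr (br e0 (pr (br e1 X))) - pr (br e1 (pr (br e0 X))) = pr (br x1 X)"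
  using jacobi[OF e0(2) e1(2), of X] assms by (simp add: data_br pr_lin)

lemma br_x1_e1: "br (br e0 e1) e1 = br e1 (br e0 e1)"
  using br_skew[OF br_part[OF e0(2) e1(2)] e1(2)] by simp

lemma D_x0: "pr (br e0 x0) = s 2 (pr (br e1 x1))"
  using jacobi[OF e0(2) e1(2), of e1] by (simp add: data_br br_x1_e1 scale_two pr_lin)

lemma \<delta>_D:
  assumes X: "X \<in> perp"
  shows "\<delta> (pr (br e0 X)) - pr (br e0 (\<delta> X)) - s mu (pr (br e1 X)) = pr (br c1 X)"
proof -
  have "\<Delta> (br e0 X) = br c1 X + s mu (br e1 X) + br e0 (\<Delta> X)"
    using \<Delta>_br[OF e0(2), of X] X by (simp add: \<Delta>_e br_lin V_cl)
  then show ?thesis using X perp_K by (simp add: pr_lin V_cl)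
qed

lemma \<delta>_Dbar:
  assumes X: "X \<in> perp"
  shows "\<delta> (pr (br e1 X)) + pr (br e1 (\<delta> X)) + s mu (pr (br e0 X)) = pr (br c0 X)"
proof -
  have "br (\<Delta> e1) X = br c0 X - s mu (br e0 X)"
    using br_lin(1)[of c0 "- s mu e0" X] br_lin(3)[of e0 X "- mu"] X
    by (simp add: \<Delta>_e V_cl)
  then have "\<Delta> (br e1 X) = br c0 X - s mu (br e0 X) - br e1 (\<Delta> X)"
    using \<Delta>_br[OF e1(2), of X] X by simp
  then show ?thesis using X perp_K by (simp add: pr_lin V_cl)
qed

lemma \<delta>_x0: "\<delta> x0 = - s (2 * mu) x1 - s 2 (pr (br e1 c0))"
proof -
  have sw: "br (\<Delta> e1) e1 = - br e1 (\<Delta> e1)"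
    using br_skew0[of "\<Delta> e1" e1] \<Delta>_part[OF e1(2)] by simp
  have "br e1 e0 = - br e0 e1" using br_skew0[OF e0(2) uw_V(4)] by simp
  then have "br e1 (\<Delta> e1) = br e1 c0 + s mu (br e0 e1)"
    using br_lin(2)[of c0 "- s mu e0" e1] br_lin(4)[of e0 e1 "- mu"]
    by (simp add: \<Delta>_e V_cl)
  moreover have "\<Delta> (br e1 e1) = - br e1 (\<Delta> e1) - br e1 (\<Delta> e1)"
    using \<Delta>_br[OF e1(2), of e1] sw by simp
  ultimately have "\<Delta> (br e1 e1) = - (br e1 c0 + s mu (br e0 e1)) - (br e1 c0 + s mu (br e0 e1))"
    by simp
  then have "\<delta> x0 = - (pr (br e1 c0) + s mu x1) - (pr (br e1 c0) + s mu x1)"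
    unfolding data_\<delta> x1_def by (simp add: pr_lin V_cl)
  moreover have "s (2 * mu) x1 = s mu x1 + s mu x1" using scale_two[of "s mu x1"] by simp
  ultimately show ?thesis by (simp add: scale_two)
qed

lemma \<delta>_x1: "\<delta> x1 = s mu x0 + pr (br e0 c0) + pr (br e1 c1)"
proof -
  have "br e0 (\<Delta> e1) = br e0 c0"
  proof -
    have "br e0 e0 = 0" using self_neg_zero br_skew0[OF e0(2) uw_V(3)] by blast
    then show ?thesis
      using br_lin(2)[of c0 "- s mu e0" e0] br_lin(4)[of e0 e0 "- mu"]
      by (simp add: \<Delta>_e V_cl)
  qed
  moreover have "br (\<Delta> e0) e1 = br e1 c1 + s mu (br e1 e1)"
    using br_skew[of c1 1 e1 1] data_part(4) e1(2) by (simp add: \<Delta>_e br_lin V_cl)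
  ultimately have "\<Delta> (br e0 e1) = br e1 c1 + s mu (br e1 e1) + br e0 c0"
    using \<Delta>_br[OF e0(2), of e1] by simp
  then show ?thesis unfolding data_\<delta> x0_def by (simp add: pr_lin V_cl)
qed

definition E :: "('a, 'b) ext_data" where
  "E = \<lparr>ext_delta = (\<lambda>x. \<delta> x), ext_D = (\<lambda>x. pr (br e0 x)), ext_Dbar = (\<lambda>x. pr (br e1 x)),
    ext_x0 = x0, ext_x1 = x1, ext_c0 = c0, ext_c1 = c1, ext_k = 0, ext_al = 0, ext_lam = l\<rparr>"

lemma E_sel [simp]:
  "ext_delta E = (\<lambda>x. \<delta> x)" "ext_D E = (\<lambda>x. pr (br e0 x))" "ext_Dbar E = (\<lambda>x. pr (br e1 x))"
  "ext_x0 E = x0" "ext_x1 E = x1" "ext_c0 E = c0" "ext_c1 E = c1" "ext_k E = 0" "ext_al E = 0"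
  "ext_lam E = l"
  by (simp_all add: E_def)

lemma ext_data_common_E: "ext_data_common s p H B \<omega> E"
  unfolding ext_data_common_def Let_def E_sel
proof (intro conjI ballI)
  fix X assume "X \<in> scarrier H"
  then have X: "X \<in> perp" by simp
  show "pr (br e1 (pr (br e1 X))) = s (1 / 2) (brk H x0 X)" using Dbar_square[OF X] by simp
  show "supercomm s 0 1 (\<lambda>x. pr (br e0 x)) (\<lambda>x. pr (br e1 x)) X = brk H x1 X"
    using D_Dbar[OF X] by (simp add: supercomm_def del: br_pr)
qed (fact lie_H quadratic_H symplectic_H symplectic_derivation_H superderivation_ad[OF e0(2)]
    skew_supersymmetric_ad[OF e0(2)] superderivation_ad[OF e1(2)] skew_supersymmetric_ad[OF e1(2)]
    data_part l Dbar_x0 D_x0)+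

lemma even_ext_data_E: assumes p: "p = 0" shows "even_ext_data s H B \<omega> E"
  unfolding even_ext_data_def Let_def E_sel
proof (intro conjI ballI)
  have mu: "mu = l" unfolding mu_def using p by simp
  show "ext_data_common s 0 H B \<omega> E" using ext_data_common_E unfolding p .
  show "B x0 x0 = 0" "l * 0 = B c0 x0" using isotropic(2) data_\<bb> by simp_all
  show "\<delta> x0 = - s (2 * l) x1 - s 2 (pr (br e1 c0))" using \<delta>_x0 unfolding mu .
  show "\<delta> x1 = s l x0 + pr (br e0 c0) + pr (br e1 c1)" using \<delta>_x1 unfolding mu .
  fix X assume "X \<in> scarrier H"
  then have X: "X \<in> perp" by simp
  show "supercomm s 1 0 (\<lambda>x. \<delta> x) (\<lambda>x. pr (br e0 x)) X - s l (pr (br e1 X)) = brk H c1 X"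
    using \<delta>_D[OF X] by (simp add: supercomm_def mu del: br_pr pr_\<Delta>_pr)
  show "supercomm s 1 1 (\<lambda>x. \<delta> x) (\<lambda>x. pr (br e1 x)) X + s l (pr (br e0 X)) = brk H c0 X"
    using \<delta>_Dbar[OF X] by (simp add: supercomm_def mu del: br_pr pr_\<Delta>_pr)
qed

lemma odd_ext_data_E: assumes p: "p \<noteq> 0" shows "odd_ext_data s H B \<omega> E"
  unfolding odd_ext_data_def Let_def E_sel
proof (intro conjI ballI)
  have mu: "mu = - l" unfolding mu_def using p by simp
  have p1: "p = 1" using p by (simp only: bit_not_zero_iff)
  show "ext_data_common s 1 H B \<omega> E" using ext_data_common_E unfolding p1 .
  show "B x0 x1 = 0" "l * 0 = B c1 x0 - 2 * B x1 c0" using isotropic(2) data_\<bb> by simp_all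
  show "\<delta> x0 = - s 2 (pr (br e1 c0)) + s (2 * l) x1" using \<delta>_x0 unfolding mu by simp
  show "\<delta> x1 = pr (br e0 c0) + pr (br e1 c1) - s l x0" using \<delta>_x1 unfolding mu by simp
  fix X assume "X \<in> scarrier H"
  then have X: "X \<in> perp" by simp
  show "brk H c0 X = supercomm s 1 1 (\<lambda>x. \<delta> x) (\<lambda>x. pr (br e1 x)) X - s l (pr (br e0 X))"
    using \<delta>_Dbar[OF X] by (simp add: supercomm_def mu del: br_pr pr_\<Delta>_pr)
  show "brk H c1 X = supercomm s 1 0 (\<lambda>x. \<delta> x) (\<lambda>x. pr (br e0 x)) X + s l (pr (br e1 X))"
    using \<delta>_D[OF X] by (simp add: supercomm_def mu del: br_pr pr_\<Delta>_pr)
qed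

section \<open>The isometry onto the extension\<close>

definition coef0 where "coef0 x = B (if p = 0 then u0 else u1) x"
definition coef1 where "coef1 x = B (if p = 0 then u1 else u0) x"

text \<open>The isomorphism sends a vector to its coordinates with respect to \<open>u0\<close>, \<open>u1\<close>, the complement, \<open>e0\<close>
  and \<open>e1\<close>. The first two coordinates are pairings with the dual vectors.\<close>

definition \<phi> :: "'b \<Rightarrow> ('a, 'b) ext" where "\<phi> x = (B x w0, B x w1, pr x, coef0 x, coef1 x)"

lemma w_swap: "s (B u0 x) w0 + s (B u1 x) w1 = s (coef0 x) e0 + s (coef1 x) e1"
  by (simp add: coef0_def coef1_def w0_def w1_def add.commute)

lemma decomp: "x = s (B x w0) u0 + s (B x w1) u1 + (pr x + s (coef0 x) e0 + s (coef1 x) e1)"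
proof -
  have "pr x = x - (s (B x w0) u0 + s (B x w1) u1 + (s (coef0 x) e0 + s (coef1 x) e1))"
    unfolding w_swap[symmetric] pr_def by (simp add: add.assoc)
  then show ?thesis by (simp add: algebra_simps)
qed

lemma coef_lin:
  assumes "x \<in> V"
  shows "y \<in> V \<Longrightarrow> coef0 (x + y) = coef0 x + coef0 y" "y \<in> V \<Longrightarrow> coef1 (x + y) = coef1 x + coef1 y"
    "coef0 (s c x) = c * coef0 x" "coef1 (s c x) = c * coef1 x"
  using assms by (simp_all add: coef0_def coef1_def B_lin)

lemma coef_zero: "B u0 x = 0 \<Longrightarrow> B u1 x = 0 \<Longrightarrow> coef0 x = 0" "B u0 x = 0 \<Longrightarrow> B u1 x = 0 \<Longrightarrow> coef1 x = 0"
  by (simp_all add: coef0_def coef1_def)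

lemma \<phi>_add: "x \<in> V \<Longrightarrow> y \<in> V \<Longrightarrow> \<phi> (x + y) = \<phi> x + \<phi> y"
  by (simp add: \<phi>_def B_lin pr_lin coef_lin)

lemma \<phi>_scale: "x \<in> V \<Longrightarrow> \<phi> (s c x) = ext_scale s c (\<phi> x)"
  by (simp add: \<phi>_def B_lin pr_lin coef_lin ext_scale_def)

lemma \<phi>_neg: "x \<in> V \<Longrightarrow> \<phi> (- x) = - \<phi> x"
  using \<phi>_scale[of x "-1"] by (simp add: ext_scale_def \<phi>_def)

lemma \<phi>_values:
  "\<phi> u0 = ext_e0s" "\<phi> u1 = ext_e1s" "X \<in> perp \<Longrightarrow> \<phi> X = ext_in X"
  "\<phi> e0 = ext_e0" "\<phi> e1 = ext_e1"
proof -
  show "\<phi> u0 = ext_e0s" "\<phi> u1 = ext_e1s" "X \<in> perp \<Longrightarrow> \<phi> X = ext_in X"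
    by (simp_all add: \<phi>_def coef_zero ext_e0s_def ext_e1s_def ext_in_def)
  have B: "B e0 w0 = 0" "B e0 w1 = 0" "B e1 w0 = 0" "B e1 w1 = 0"
    using isotropic(2) e0(1) e1(1) w0(1) w1(1) by simp_all
  have f: "coef0 e0 = 1" "coef0 e1 = 0" "coef1 e0 = 0" "coef1 e1 = 1"
    using B_uw unfolding coef0_def coef1_def w0_def w1_def by presburger+
  have "pr e0 = 0" "pr e1 = 0"
    using decomp[of e0] decomp[of e1] unfolding B f by simp_all
  then show "\<phi> e0 = ext_e0" "\<phi> e1 = ext_e1"
    by (simp_all add: \<phi>_def B f ext_e0_def ext_e1_def)
qed

text \<open>The description of the parity involution on sums of homogeneous elements, by uniqueness of the
  homogeneous components.\<close>

lemma parity_inv_H: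
  assumes "y \<in> part H 0" "z \<in> part H 1" shows "parity_inv H (y + z) = y - z"
  unfolding parity_inv_def
proof (rule the_equality)
  show "\<exists>u\<in>part H 0. \<exists>v\<in>part H 1. y + z = u + v \<and> y - z = u - v" using assms by blast
next
  fix t assume "\<exists>u\<in>part H 0. \<exists>v\<in>part H 1. y + z = u + v \<and> t = u - v"
  then obtain u v where uv: "u \<in> part H 0" "v \<in> part H 1" "y + z = u + v" "t = u - v" by blast
  have sub: "subspace (part H d)" for d
    by (simp add: subspace_inter subspace_part subspace_perp)
  have int: "part H 0 \<inter> part H 1 = {0}"
    using lie_H unfolding lie_superalgebra_def by (elim conjE)
  have "y - u \<in> part H 0" "v - z \<in> part H 1" using subspace_diff[OF sub] assms uv(1,2) by blast+
  moreover have eq: "y - u = v - z" using uv(3) by (simp add: algebra_simps)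
  ultimately have "y - u \<in> part H 0 \<inter> part H 1" by (simp only: Int_iff)
  then have "y - u = 0" unfolding int by (rule singletonD)
  then show "t = y - z" using eq uv(4) by simp
qed

lemma br_e1_right:
  assumes "X \<in> perp"
  shows "br X e1 = - br e1 (parity_inv H X)" "parity_inv H X \<in> perp"
proof -
  have "X \<in> scarrier H" using assms by simp
  then obtain y z where yz: "y \<in> part H 0" "z \<in> part H 1" "X = y + z" unfolding scarrier_def by blast
  have P: "parity_inv H X = y - z" using parity_inv_H[OF yz(1,2)] yz(3) by simp
  have y: "y \<in> part G 0" "y \<in> perp" and z: "z \<in> part G 1" "z \<in> perp" using yz by simp_all
  show "parity_inv H X \<in> perp" unfolding P using subspace_diff[OF subspace_perp y(2) z(2)] .
  have "br y e1 = - br e1 y" "br z e1 = br e1 z"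
    using br_skew0[OF y(1) uw_V(4)] br_skew[OF z(1) e1(2)] by simp_all
  then have "br X e1 = - br e1 y + br e1 z" unfolding yz(3) using y z by (simp add: br_lin)
  moreover have "br e1 (y - z) = br e1 y - br e1 z"
    using br_lin(2)[of y "- z" e1] br_lin(4)[of z e1 "-1"] y(2) z(2) V_cl(4) by simp
  ultimately show "br X e1 = - br e1 (parity_inv H X)" unfolding P by simp
qed

lemma br_e0_e0: "br e0 e0 = 0"
  using self_neg_zero br_skew0[OF e0(2) uw_V(3)] by blast

lemma br_e1_e0: "br e1 e0 = - br e0 e1"
  using br_skew0[OF e0(2) uw_V(4)] by simp

text \<open>The central parts of both arguments drop out; what remains is bilinear expansion, with the brackets
  normalized so that \<open>e0\<close> or \<open>e1\<close> is on the left.\<close>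

lemma br_expand:
  assumes "x \<in> V" "y \<in> V"
  shows "br x y = br (pr x) (pr y) + s (coef0 x) (br e0 (pr y)) - s (coef0 y) (br e0 (pr x))
    + s (coef1 x) (br e1 (pr y)) - s (coef1 y) (br e1 (parity_inv H (pr x)))
    + s (coef0 x * coef1 y - coef1 x * coef0 y) (br e0 e1) + s (coef1 x * coef1 y) (br e1 e1)"
proof -
  define X Y where "X = pr x" and "Y = pr y"
  have XY: "X \<in> perp" "Y \<in> perp" using assms by (simp_all add: X_def Y_def)
  define a0 a1 b0 b1 where "a0 = coef0 x" and "a1 = coef1 x" and "b0 = coef0 y" and "b1 = coef1 y"
  define x' y' where "x' = X + s a0 e0 + s a1 e1" and "y' = Y + s b0 e0 + s b1 e1"
  have V': "x' \<in> V" "y' \<in> V" using XY by (simp_all add: x'_def y'_def V_cl)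
  define cx cy where "cx = s (B x w0) u0 + s (B x w1) u1" and "cy = s (B y w0) u0 + s (B y w1) u1"
  have x: "x = cx + x'" and y: "y = cy + y'"
    unfolding cx_def cy_def x'_def y'_def X_def Y_def a0_def a1_def b0_def b1_def
    by (rule decomp)+
  have c: "cx \<in> V" "cy \<in> V" "\<And>z. z \<in> V \<Longrightarrow> br cx z = 0" "\<And>z. z \<in> V \<Longrightarrow> br z cy = 0"
    by (simp_all add: cx_def cy_def V_cl br_lin central central_right)
  have "br x y = br cx y + br x' y" using br_lin(1)[OF c(1) V'(1) assms(2)] x by simp
  also have "\<dots> = br x' cy + br x' y'"
    using br_lin(2)[OF c(2) V'(2) V'(1)] y c(3)[OF assms(2)] by simp
  also have "\<dots> = br x' y'" using c(4)[OF V'(1)] by simp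
  also have "\<dots> = br X Y + s b0 (br X e0) + s b1 (br X e1)
      + s a0 (br e0 Y + s b0 (br e0 e0) + s b1 (br e0 e1))
      + s a1 (br e1 Y + s b0 (br e1 e0) + s b1 (br e1 e1))"
    using XY by (simp add: x'_def y'_def br_lin V_cl scale_right_distrib algebra_simps)
  also have "br X e0 = - br e0 X" using br_skew0[OF e0(2), of X] XY by simp
  finally show ?thesis
    unfolding br_e0_e0 br_e1_e0 br_e1_right(1)[OF XY(1)] X_def[symmetric] Y_def[symmetric]
      a0_def[symmetric] a1_def[symmetric] b0_def[symmetric] b1_def[symmetric]
    by (simp add: scale_right_distrib scale_left_diff_distrib algebra_simps)
qed

lemma \<phi>_diff: "x \<in> V \<Longrightarrow> y \<in> V \<Longrightarrow> \<phi> (x - y) = \<phi> x - \<phi> y"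
  using \<phi>_add[of x "- y"] \<phi>_neg[of y] V_cl(4)[of y] by simp

text \<open>Both brackets are determined by their values on the complement and on \<open>e0\<close>, \<open>e1\<close>, so it suffices
  to compare those values, independently of the parity.\<close>

lemma \<phi>_br:
  assumes x: "x \<in> V" "y \<in> V"
    and hh: "\<And>X Y. X \<in> perp \<Longrightarrow> Y \<in> perp \<Longrightarrow> \<phi> (br X Y) = hh X Y"
    and g0: "\<And>X. X \<in> perp \<Longrightarrow> \<phi> (br e0 X) = g0 X"
    and g1: "\<And>X. X \<in> perp \<Longrightarrow> \<phi> (br e1 X) = g1 X"
    and g: "\<phi> (br e0 e1) = e01" "\<phi> (br e1 e1) = e11"
  shows "\<phi> (br x y) = ext_bracket s H hh g0 g1 e01 e11 (\<phi> x) (\<phi> y)"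
proof -
  have X: "pr x \<in> perp" "pr y \<in> perp" "parity_inv H (pr x) \<in> perp"
    using x br_e1_right(2) by simp_all
  have "\<phi> (br x y) = \<phi> (br (pr x) (pr y)) + ext_scale s (coef0 x) (\<phi> (br e0 (pr y)))
      - ext_scale s (coef0 y) (\<phi> (br e0 (pr x))) + ext_scale s (coef1 x) (\<phi> (br e1 (pr y)))
      - ext_scale s (coef1 y) (\<phi> (br e1 (parity_inv H (pr x))))
      + ext_scale s (coef0 x * coef1 y - coef1 x * coef0 y) (\<phi> (br e0 e1))
      + ext_scale s (coef1 x * coef1 y) (\<phi> (br e1 e1))"
    unfolding br_expand[OF x] using X
    by (simp add: \<phi>_add \<phi>_diff \<phi>_scale V_cl del: br_pr)
  also have "\<dots> = ext_bracket s H hh g0 g1 e01 e11 (\<phi> x) (\<phi> y)"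
    unfolding g hh[OF X(1,2)] g0[OF X(1)] g0[OF X(2)] g1[OF X(2)] g1[OF X(3)]
    by (simp only: ext_bracket_def \<phi>_def prod.case)
  finally show ?thesis .
qed

lemma \<phi>_\<Delta>:
  assumes x: "x \<in> V" and g: "\<And>X. X \<in> perp \<Longrightarrow> \<phi> (\<Delta> X) = g X"
  shows "\<phi> (\<Delta> x) = ext_linear s (\<phi> (\<Delta> u0)) (\<phi> (\<Delta> u1)) g (\<phi> (\<Delta> e0)) (\<phi> (\<Delta> e1)) (\<phi> x)"
proof -
  have X: "pr x \<in> perp" using x by simp
  have "\<Delta> x = \<Delta> (s (B x w0) u0 + s (B x w1) u1 + (pr x + s (coef0 x) e0 + s (coef1 x) e1))"
    using decomp[of x] by (rule arg_cong)
  also have "\<dots> = s (B x w0) (\<Delta> u0) + s (B x w1) (\<Delta> u1)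
      + (\<Delta> (pr x) + s (coef0 x) (\<Delta> e0) + s (coef1 x) (\<Delta> e1))"
    using X by (simp add: \<Delta>_lin V_cl)
  finally have "\<phi> (\<Delta> x) = ext_scale s (B x w0) (\<phi> (\<Delta> u0)) + ext_scale s (B x w1) (\<phi> (\<Delta> u1))
      + (\<phi> (\<Delta> (pr x)) + ext_scale s (coef0 x) (\<phi> (\<Delta> e0)) + ext_scale s (coef1 x) (\<phi> (\<Delta> e1)))"
    using X by (simp add: \<phi>_add \<phi>_scale V_cl)
  then show ?thesis unfolding g[OF X] ext_linear_def \<phi>_def[of x] by (simp add: add.assoc)
qed

lemma B_expand:
  assumes "x \<in> V" "y \<in> V"
  shows "B x y = B (pr x) (pr y) + B x w0 * B u0 y + B u0 x * B y w0
    + B x w1 * B u1 y + ksign (p + 1) * B u1 x * B y w1"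
proof -
  have y: "y = pr y + (s (B y w0) u0 + s (B y w1) u1 + s (B u0 y) w0 + s (B u1 y) w1)"
    by (simp add: pr_def)
  have "B x y = B x (pr y) + (B y w0 * B x u0 + B y w1 * B x u1 + B u0 y * B x w0 + B u1 y * B x w1)"
    by (subst y) (use assms in \<open>simp add: B_lin V_cl del: B_pr\<close>)
  moreover have "B x (pr y) = B (pr x) (pr y)" using assms by (simp del: B_pr(2))
  moreover have "B x u0 = B u0 x" using B_swap[OF u0(2) assms(1)] by simp
  moreover have "B x u1 = ksign (p + 1) * B u1 x"
    using B_swap[OF u1(2) assms(1)] by (simp only: mult_1 ksign_simps)
  ultimately show ?thesis by (simp only: algebra_simps)
qed

lemma scarrier_ext:
  fixes T :: "('a, 'b) ext superalgebra"
  assumes "part T = ext_part H"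
  shows "scarrier T = {(q0, q1, X, a0, a1) | q0 q1 X a0 a1. X \<in> perp}"
proof
  show "scarrier T \<subseteq> {(q0, q1, X, a0, a1) | q0 q1 X a0 a1. X \<in> perp}"
    unfolding scarrier_def assms ext_part_def using perp_cl(1) by auto
  show "{(q0, q1, X, a0, a1) | q0 q1 X a0 a1. X \<in> perp} \<subseteq> scarrier T"
  proof
    fix t :: "('a, 'b) ext" assume "t \<in> {(q0, q1, X, a0, a1) | q0 q1 X a0 a1. X \<in> perp}"
    then obtain q0 q1 X a0 a1 where t: "t = (q0, q1, X, a0, a1)" and "X \<in> scarrier H" by auto
    then obtain y z where yz: "y \<in> part H 0" "z \<in> part H 1" "X = y + z"
      unfolding scarrier_def by blast
    have "t = (q0, 0, y, a0, 0) + (0, q1, z, 0, a1)" using t yz by simp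
    moreover have "(q0, 0, y, a0, 0) \<in> ext_part H 0" "(0, q1, z, 0, a1) \<in> ext_part H 1"
      using yz unfolding ext_part_def by simp_all
    ultimately show "t \<in> scarrier T" unfolding scarrier_def assms by blast
  qed
qed

lemma \<phi>_part:
  assumes x: "x \<in> part G d" shows "\<phi> x \<in> ext_part H d"
proof -
  have pr: "pr x \<in> part H d" using pr_part[OF x] pr_perp[OF part_V[OF x]] by simp
  show ?thesis
  proof (cases "d = 0")
    case True
    have "B x w1 = 0" by (rule B_parity[OF _ x w1(2)]) (cases "p = 0"; simp add: True)
    moreover have "coef1 x = 0"
      using B_parity[OF _ u1(2) x] B_parity[OF _ u0(2) x] True by (simp add: coef1_def)
    ultimately show ?thesis using pr True by (simp add: \<phi>_def ext_part_def)
  next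
    case False
    then have d: "d = 1" by (simp only: bit_not_zero_iff)
    have "B x w0 = 0" by (rule B_parity[OF _ x w0(2)]) (cases "p = 0"; simp add: d)
    moreover have "coef0 x = 0"
      using B_parity[OF _ u1(2) x] B_parity[OF _ u0(2) x] d by (simp add: coef0_def)
    ultimately show ?thesis using pr d by (simp add: \<phi>_def ext_part_def)
  qed
qed

lemma \<phi>_bij:
  fixes T :: "('a, 'b) ext superalgebra"
  assumes "part T = ext_part H" shows "bij_betw \<phi> V (scarrier T)"
  unfolding bij_betw_def
proof
  show "inj_on \<phi> V"
  proof (rule inj_onI)
    fix x y assume "\<phi> x = \<phi> y"
    then have eq: "B x w0 = B y w0" "B x w1 = B y w1" "pr x = pr y" "coef0 x = coef0 y" "coef1 x = coef1 y"
      by (simp_all add: \<phi>_def)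
    show "x = y" using decomp[of x] unfolding eq using decomp[of y] by (rule trans[OF _ sym])
  qed
  show "\<phi> ` V = scarrier T"
  proof
    show "\<phi> ` V \<subseteq> scarrier T" unfolding scarrier_ext[OF assms] by (auto simp: \<phi>_def)
    show "scarrier T \<subseteq> \<phi> ` V"
    proof
      fix t assume "t \<in> scarrier T"
      then obtain q0 q1 X a0 a1 where t: "t = (q0, q1, X, a0, a1)" and X: "X \<in> perp"
        unfolding scarrier_ext[OF assms] by blast
      define z where "z = s q0 u0 + s q1 u1 + X + s a0 e0 + s a1 e1"
      have "z \<in> V" using X by (simp add: z_def V_cl)
      moreover have "t = \<phi> z" unfolding z_def t using X
        by (simp add: \<phi>_add \<phi>_scale V_cl \<phi>_values ext_scale_def ext_e0s_def ext_e1s_def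
            ext_in_def ext_e0_def ext_e1_def)
      ultimately show "t \<in> \<phi> ` V" by (rule rev_image_eqI)
    qed
  qed
qed

lemma lie_bi_isometry_\<phi>:
  assumes T: "part T = ext_part H"
    and br: "\<And>x y. x \<in> V \<Longrightarrow> y \<in> V \<Longrightarrow> \<phi> (br x y) = brk T (\<phi> x) (\<phi> y)"
    and form: "\<And>x y. x \<in> V \<Longrightarrow> y \<in> V \<Longrightarrow> B x y = \<gamma> (\<phi> x) (\<phi> y)"
    and der: "\<And>x. x \<in> V \<Longrightarrow> \<phi> (\<Delta> x) = d (\<phi> x)"
  shows "lie_bi_isometry s G B \<omega> (ext_scale s) T \<gamma> (\<lambda>u v. \<gamma> (d u) v) \<phi>"
  unfolding lie_bi_isometry_def
proof (intro conjI allI ballI)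
  show "linear_on s (ext_scale s) V \<phi>" unfolding linear_on_def using \<phi>_add \<phi>_scale by blast
  show "bij_betw \<phi> V (scarrier T)" using \<phi>_bij[OF T] .
  show "\<phi> ` part G a \<subseteq> part T a" for a unfolding T using \<phi>_part by blast
  fix x y assume xy: "x \<in> V" "y \<in> V"
  show "\<phi> (br x y) = brk T (\<phi> x) (\<phi> y)" "B x y = \<gamma> (\<phi> x) (\<phi> y)" using br form xy by blast+
  have "\<omega> x y = B (\<Delta> x) y" using \<omega>_def xy .
  also have "\<dots> = \<gamma> (\<phi> (\<Delta> x)) (\<phi> y)" using form xy \<Delta>_V by blast
  finally show "\<omega> x y = \<gamma> (d (\<phi> x)) (\<phi> y)" unfolding der[OF xy(1)] .
qed

lemma B_e_swap:
  assumes "x \<in> V"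
  shows "B x e0 = B e0 x" "B x e1 = ksign (p + 1) * B e1 x"
  using B_swap[OF e0(2) assms] B_swap[OF e1(2) assms] by (simp_all only: mult_1 ksign_simps mult_zero_left)

text \<open>The central components of a bracket are its pairings with \<open>e0\<close> and \<open>e1\<close>; invariance turns them into
  the forms built from \<open>D\<close>, \<open>Dbar\<close>, \<open>x0\<close> and \<open>x1\<close> that occur in the bracket of the extension.\<close>

lemma B_br_e:
  assumes "z \<in> V" "X \<in> V"
  shows "B (br z X) e0 = B (br e0 z) X" "B (br z X) e1 = ksign (p + 1) * B (br e1 z) X"
  using assms by (simp_all add: B_e_swap B_inv)

lemma B_\<Delta>_e:
  assumes "X \<in> V" shows "B (\<Delta> X) e0 = - B (\<Delta> e0) X" "B (\<Delta> X) e1 = - ksign p * B (\<Delta> e1) X"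
proof -
  show "B (\<Delta> X) e0 = - B (\<Delta> e0) X" using \<Delta>_swap[OF e0(2) assms] by simp
  have "B (\<Delta> e1) X = - ksign p * B (\<Delta> X) e1"
    using \<Delta>_swap[OF e1(2) assms] by (simp add: add.assoc)
  then show "B (\<Delta> X) e1 = - ksign p * B (\<Delta> e1) X" by simp
qed

lemma coef_br: "x \<in> V \<Longrightarrow> y \<in> V \<Longrightarrow> coef0 (br x y) = 0" "x \<in> V \<Longrightarrow> y \<in> V \<Longrightarrow> coef1 (br x y) = 0"
  using br_K[of x y] by (simp_all add: coef_zero K_def)

lemma coef_\<Delta>: "X \<in> perp \<Longrightarrow> coef0 (\<Delta> X) = 0" "X \<in> perp \<Longrightarrow> coef1 (\<Delta> X) = 0"
  by (simp_all add: coef_zero B_u\<Delta>)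

lemma B_br_ee: "B (br e0 e1) e0 = 0" "B (br e0 e1) e1 = 0" "B (br e1 e1) e0 = 0" "B (br e1 e1) e1 = 0"
  using isotropic(2) e_stable_\<bb> e0(1) e1(1) by blast+

lemma B_data:
  assumes "X \<in> perp"
  shows "B x0 X = B (br e1 e1) X" "B x1 X = B (br e0 e1) X" "B c0 X = B (\<Delta> e1) X" "B c1 X = B (\<Delta> e0) X"
  using assms by (simp_all add: x0_def x1_def c0_def c1_def)

lemmas ext_component_simps = zero_prod_def ext_scale_def ext_e0s_def ext_e1s_def ext_in_def ext_e0_def ext_e1_def

lemma \<phi>_\<Delta>_frame:
  "\<phi> (\<Delta> u0) = ext_scale s l ext_e1s" "\<phi> (\<Delta> u1) = ext_scale s l ext_e0s"
  "\<phi> (\<Delta> e0) = ext_in c1 + ext_scale s mu ext_e1" "\<phi> (\<Delta> e1) = ext_in c0 - ext_scale s mu ext_e0"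
  by (simp_all add: \<Delta>_u \<Delta>_e \<phi>_add \<phi>_diff \<phi>_scale \<phi>_values V_cl)

lemma even_isometry:
  assumes p: "p = 0"
  shows "lie_bi_isometry s G B \<omega> (ext_scale s) (even_ext s H B E) (even_ext_form B)
    (\<lambda>u v. even_ext_form B (even_ext_derivation s B E u) v) \<phi>"
proof (rule lie_bi_isometry_\<phi>)
  have w: "w0 = e0" "w1 = e1" and f: "coef0 = B u0" "coef1 = B u1" and mu: "mu = l"
    and k: "ksign (p + 1) = (-1 :: 'a)" "ksign p = (1 :: 'a)"
    unfolding w0_def w1_def coef0_def coef1_def mu_def using p by (simp_all add: fun_eq_iff)
  note B_br = B_br_e[unfolded k] and B\<Delta> = B_\<Delta>_e[unfolded k]
  show "part (even_ext s H B E) = ext_part H" by (simp add: even_ext_def Let_def)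
  show "\<phi> (br x y) = brk (even_ext s H B E) (\<phi> x) (\<phi> y)" if xy: "x \<in> V" "y \<in> V" for x y
    unfolding even_ext_def Let_def E_sel superalgebra.simps
  proof (rule \<phi>_br[OF xy])
    fix X Y assume XY: "X \<in> perp" "Y \<in> perp"
    show "\<phi> (br X Y) = ext_in (brk H X Y) - ext_scale s (B (pr (br e1 X)) Y) ext_e1s
        + ext_scale s (B (pr (br e0 X)) Y) ext_e0s"
      using XY by (simp add: \<phi>_def w coef_br B_br ext_component_simps)
  next
    fix X assume X: "X \<in> perp"
    show "\<phi> (br e0 X) = ext_in (pr (br e0 X)) + ext_scale s (B x1 X) ext_e1s"
      using X by (simp add: \<phi>_def w coef_br B_br br_e0_e0 br_e1_e0 B_neg B_data ext_component_simps)
    show "\<phi> (br e1 X) = ext_in (pr (br e1 X)) - ext_scale s (B x0 X) ext_e1s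
        + ext_scale s (B x1 X) ext_e0s"
      using X by (simp add: \<phi>_def w coef_br B_br B_data ext_component_simps)
  next
    show "\<phi> (br e0 e1) = ext_scale s 0 ext_e1s + ext_in x1"
      "\<phi> (br e1 e1) = ext_scale s 0 ext_e0s + ext_in x0"
      by (simp_all add: \<phi>_def w coef_br B_br_ee x0_def x1_def ext_component_simps)
  qed
  show "B x y = even_ext_form B (\<phi> x) (\<phi> y)" if "x \<in> V" "y \<in> V" for x y
    unfolding B_expand[OF that] k by (simp add: even_ext_form_def \<phi>_def f)
  show "\<phi> (\<Delta> x) = even_ext_derivation s B E (\<phi> x)" if x: "x \<in> V" for x
  proof -
    have "\<phi> (\<Delta> X) = - ext_scale s (B c1 X) ext_e0s + ext_in (\<delta> X) - ext_scale s (B c0 X) ext_e1s"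
      if "X \<in> perp" for X
      using that by (simp add: \<phi>_def w coef_\<Delta> B\<Delta> B_data ext_component_simps)
    note \<phi>_\<Delta>[OF x this, unfolded \<phi>_\<Delta>_frame mu]
    moreover have "ext_scale s 0 t = 0" for t :: "('a, 'b) ext"
      by (cases t) (simp add: ext_scale_def zero_prod_def)
    ultimately show ?thesis unfolding even_ext_derivation_def Let_def E_sel by simp
  qed
qed

lemma odd_isometry:
  assumes p: "p \<noteq> 0"
  shows "lie_bi_isometry s G B \<omega> (ext_scale s) (odd_ext s H B E) (odd_ext_form B)
    (\<lambda>u v. odd_ext_form B (odd_ext_derivation s B E u) v) \<phi>"
proof (rule lie_bi_isometry_\<phi>)
  have w: "w0 = e1" "w1 = e0" and f: "coef0 = B u1" "coef1 = B u0" and mu: "mu = - l"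
    and k: "ksign (p + 1) = (1 :: 'a)" "ksign p = (-1 :: 'a)"
    unfolding w0_def w1_def coef0_def coef1_def mu_def using p by (simp_all add: fun_eq_iff)
  note B_br = B_br_e[unfolded k] and B\<Delta> = B_\<Delta>_e[unfolded k]
  show "part (odd_ext s H B E) = ext_part H" by (simp add: odd_ext_def Let_def)
  show "\<phi> (br x y) = brk (odd_ext s H B E) (\<phi> x) (\<phi> y)" if xy: "x \<in> V" "y \<in> V" for x y
    unfolding odd_ext_def Let_def E_sel superalgebra.simps
  proof (rule \<phi>_br[OF xy])
    fix X Y assume XY: "X \<in> perp" "Y \<in> perp"
    show "\<phi> (br X Y) = ext_in (brk H X Y) + ext_scale s (B (pr (br e1 X)) Y) ext_e0s
        + ext_scale s (B (pr (br e0 X)) Y) ext_e1s"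
      using XY by (simp add: \<phi>_def w coef_br B_br ext_component_simps)
  next
    fix X assume X: "X \<in> perp"
    show "\<phi> (br e0 X) = ext_in (pr (br e0 X)) - ext_scale s (B x1 X) ext_e0s"
      using X by (simp add: \<phi>_def w coef_br B_br br_e0_e0 br_e1_e0 B_neg B_data ext_component_simps)
    show "\<phi> (br e1 X) = ext_in (pr (br e1 X)) + ext_scale s (B x0 X) ext_e0s
        + ext_scale s (B x1 X) ext_e1s"
      using X by (simp add: \<phi>_def w coef_br B_br B_data ext_component_simps)
  next
    show "\<phi> (br e0 e1) = ext_in x1" "\<phi> (br e1 e1) = ext_scale s 0 ext_e0s + ext_in x0"
      by (simp_all add: \<phi>_def w coef_br B_br_ee x0_def x1_def ext_component_simps)
  qed
  show "B x y = odd_ext_form B (\<phi> x) (\<phi> y)" if "x \<in> V" "y \<in> V" for x y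
    unfolding B_expand[OF that] k by (simp add: odd_ext_form_def \<phi>_def f w)
  show "\<phi> (\<Delta> x) = odd_ext_derivation s B E (\<phi> x)" if x: "x \<in> V" for x
  proof -
    have "\<phi> (\<Delta> X) = ext_scale s (B c0 X) ext_e0s + ext_in (\<delta> X) - ext_scale s (B c1 X) ext_e1s"
      if "X \<in> perp" for X
      using that by (simp add: \<phi>_def w coef_\<Delta> B\<Delta> B_data ext_component_simps)
    note \<phi>_\<Delta>[OF x this, unfolded \<phi>_\<Delta>_frame mu]
    moreover have "ext_scale s 0 t = 0" "ext_scale s (- c) t = - ext_scale s c t"
      for c and t :: "('a, 'b) ext"
      by (cases t; simp add: ext_scale_def zero_prod_def)+
    ultimately show ?thesis unfolding odd_ext_derivation_def Let_def E_sel by simp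
  qed
qed

lemma double_extension_of_H:
  "special_manin s p H (\<aa> \<inter> perp) (\<bb> \<inter> perp) B \<omega>"
  "if p = 0 then is_generalized_double_extension s G B \<omega> H B \<omega>
   else is_generalized_odd_double_extension s G B \<omega> H B \<omega>"
  using special_manin_H even_ext_data_E even_isometry odd_ext_data_E odd_isometry
  unfolding is_generalized_double_extension_def is_generalized_odd_double_extension_def
  by (auto split: if_splits)

end

section \<open>A central plane stable under the symplectic derivation\<close>

context symplectic_manin
begin

lemma part_disjoint: "x \<in> part G d \<Longrightarrow> x \<in> part G (d + 1) \<Longrightarrow> x = 0"
proof -
  have "part G 0 \<inter> part G 1 = {0}" using lieG unfolding lie_superalgebra_def by (elim conjE)
  then have "x \<in> part G 0 \<Longrightarrow> x \<in> part G 1 \<Longrightarrow> x = 0" by blast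
  then show "x \<in> part G d \<Longrightarrow> x \<in> part G (d + 1) \<Longrightarrow> x = 0" by (cases "d = 0") simp_all
qed

text \<open>Bracketing with a homogeneous element sends the two components to different degrees, so their
  brackets cannot cancel.\<close>

lemma center_graded:
  assumes x: "x0 \<in> part G 0" "x1 \<in> part G 1" and c: "\<And>y. y \<in> V \<Longrightarrow> br (x0 + x1) y = 0"
    and y: "y \<in> V"
  shows "br x0 y = 0 \<and> br x1 y = 0"
  using y
proof (induction y rule: homogeneous_induct)
  case (hom d y)
  have "br x0 y + br x1 y = 0"
    using c[OF part_V[OF hom]] br_lin(1)[OF part_V[OF x(1)] part_V[OF x(2)] part_V[OF hom]] by simp
  then have eq: "br x0 y = - br x1 y" by (rule iffD1[OF eq_neg_iff_add_eq_0[symmetric]])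
  have "br x0 y \<in> part G d" using br_part[OF x(1) hom] by (simp only: add_0)
  moreover have "br x0 y \<in> part G (d + 1)"
    unfolding eq using subspace_neg[OF subspace_part br_part[OF x(2) hom]] by (simp only: add.commute)
  ultimately have 0: "br x0 y = 0" by (rule part_disjoint)
  then show ?case using eq by simp
next
  case (add y z)
  then show ?case using br_lin(2) part_V[OF x(1)] part_V[OF x(2)] by simp
qed

lemma \<Delta>_central:
  assumes x: "x \<in> part G d" "\<And>y. y \<in> V \<Longrightarrow> br x y = 0" and y: "y \<in> V"
  shows "br (\<Delta> x) y = 0"
  using \<Delta>_br[OF x(1) y] x(2) y by simp

text \<open>A vector of \<open>\<aa>\<close> must pair non-trivially with \<open>\<bb>\<close>, as \<open>B\<close> is non-degenerate and \<open>\<aa>\<close> isotropic; by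
  parity only one homogeneous component of the partner matters.\<close>

lemma dual_vector:
  assumes u: "u \<in> \<aa>" "u \<in> part G d" "u \<noteq> 0"
  shows "\<exists>e\<in>\<bb>. e \<in> part G (p + d) \<and> B u e = 1"
proof -
  have uV: "u \<in> V" using \<aa>_V[OF u(1)] .
  obtain y where y: "y \<in> V" "B u y \<noteq> 0" using nondegB[OF uV] u(3) by blast
  obtain a b where ab: "a \<in> \<aa>" "b \<in> \<bb>" "y = a + b" using y(1) unfolding V_sum by blast
  have "B u b \<noteq> 0"
    using y(2) B_lin(2)[OF \<aa>_V[OF ab(1)] \<bb>_V[OF ab(2)] uV] isotropic(1)[OF u(1) ab(1)] ab(3)
    by simp
  moreover obtain b0 b1 where b: "b0 \<in> \<bb>" "b0 \<in> part G 0" "b1 \<in> \<bb>" "b1 \<in> part G 1" "b = b0 + b1"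
    using \<bb>_cases[OF ab(2)] .
  ultimately have "B u b0 \<noteq> 0 \<or> B u b1 \<noteq> 0"
    using B_lin(2)[OF \<bb>_V[OF b(1)] \<bb>_V[OF b(3)] uV] by auto
  then obtain t g where t: "t \<in> \<bb>" "t \<in> part G g" "B u t \<noteq> 0" using b by blast
  have "d + g = p" using B_parity[OF _ u(2) t(2)] t(3) by blast
  then have g: "g = p + d" by (cases "d = 0"; cases "g = 0"; simp)
  have "B u (s (1 / B u t) t) = 1" using B_lin(4)[OF \<bb>_V[OF t(1)] uV] t(3) by simp
  moreover have "s (1 / B u t) t \<in> \<bb>" "s (1 / B u t) t \<in> part G (p + d)"
    using subspace_scale[OF subspace_\<bb> t(1)] subspace_scale[OF subspace_part t(2)] g by simp_all
  ultimately show ?thesis by blast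
qed

lemma even_central_vector:
  assumes "scenter G \<inter> \<aa> \<noteq> {0}"
  shows "\<exists>x\<in>\<aa>. x \<in> part G 0 \<and> x \<noteq> 0 \<and> (\<forall>y\<in>V. br x y = 0)"
proof -
  have "br 0 y = 0" if "y \<in> V" for y using br_lin(1)[OF V_zero V_zero that] by simp
  then have "0 \<in> scenter G \<inter> \<aa>"
    using subspace_0[OF subspace_\<aa>] by (simp add: scenter_def)
  then obtain x where x: "x \<in> scenter G" "x \<in> \<aa>" "x \<noteq> 0" using assms by blast
  obtain x0 x1 where *: "x0 \<in> \<aa>" "x0 \<in> part G 0" "x1 \<in> \<aa>" "x1 \<in> part G 1" "x = x0 + x1"
    using \<aa>_cases[OF x(2)] .
  have c: "br x0 y = 0 \<and> br x1 y = 0" if "y \<in> V" for y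
    by (rule center_graded[OF *(2,4) _ that]) (use x(1) *(5) in \<open>simp add: scenter_def\<close>)
  show ?thesis
  proof (cases "x0 = 0")
    case False
    then show ?thesis using c *(1,2) by blast
  next
    case True
    then have "x1 \<noteq> 0" using x(3) *(5) by simp
    then have "\<Delta> x1 \<noteq> 0" using \<Delta>_inj[OF part_V[OF *(4)]] by blast
    moreover have "\<Delta> x1 \<in> \<aa>" using *(3) \<Delta>_\<aa> by blast
    moreover have "\<Delta> x1 \<in> part G 0" using \<Delta>_part[OF *(4)] by simp
    moreover have "\<forall>y\<in>V. br (\<Delta> x1) y = 0" using \<Delta>_central[OF *(4)] c by blast
    ultimately show ?thesis by blast
  qed
qed

text \<open>Being odd and injective, \<open>\<Delta>\<close> has no homogeneous eigenvectors, but its square preserves the even central part of \<open>\<aa>\<close>.\<close>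

lemma central_eigenvector:
  assumes "scenter G \<inter> \<aa> \<noteq> {0}"
  shows "\<exists>\<mu>. \<exists>x\<in>\<aa>. x \<in> part G 0 \<and> x \<noteq> 0 \<and> (\<forall>y\<in>V. br x y = 0) \<and> \<Delta> (\<Delta> x) = s \<mu> x"
proof -
  define W where "W = {x \<in> \<aa> \<inter> part G 0. \<forall>y\<in>V. br x y = 0}"
  have WV: "x \<in> V" if "x \<in> W" for x using that part_V unfolding W_def by blast
  have sub: "subspace W"
    unfolding subspace_def
  proof (intro conjI allI ballI)
    have "br 0 y = 0" if "y \<in> V" for y using br_lin(1)[OF V_zero V_zero that] by simp
    then show "0 \<in> W" using subspace_0[OF subspace_\<aa>] subspace_0[OF subspace_part] by (simp add: W_def)
    fix x assume x: "x \<in> W"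
    show "x + y \<in> W" if y: "y \<in> W" for y
      using x y WV[OF x] WV[OF y] subspace_add[OF subspace_\<aa>] subspace_add[OF subspace_part]
      by (simp add: W_def br_lin)
    show "s c x \<in> W" for c
      using x WV[OF x] subspace_scale[OF subspace_\<aa>] subspace_scale[OF subspace_part]
      by (simp add: W_def br_lin)
  qed
  obtain S where S: "finite S" "span S = V"
    using lieG unfolding lie_superalgebra_def by (elim conjE exE)
  then have S': "W \<subseteq> span S" using WV by blast
  have lin: "linear_on s s W (\<lambda>x. \<Delta> (\<Delta> x))"
    unfolding linear_on_def using WV by (simp add: \<Delta>_lin)
  have inv: "\<Delta> (\<Delta> x) \<in> W" if x: "x \<in> W" for x
  proof -
    have x': "x \<in> \<aa>" "x \<in> part G 0" "\<And>y. y \<in> V \<Longrightarrow> br x y = 0" using x by (auto simp: W_def)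
    have 1: "\<Delta> x \<in> part G 1" using \<Delta>_part[OF x'(2)] by simp
    have 2: "br (\<Delta> x) y = 0" if "y \<in> V" for y by (rule \<Delta>_central[OF x'(2,3) that])
    have 3: "br (\<Delta> (\<Delta> x)) y = 0" if "y \<in> V" for y by (rule \<Delta>_central[OF 1 2 that])
    have "\<Delta> (\<Delta> x) \<in> part G 0" using \<Delta>_part[OF 1] by simp
    moreover have "\<Delta> (\<Delta> x) \<in> \<aa>" using x'(1) \<Delta>_\<aa> by blast
    ultimately show ?thesis using 3 by (simp add: W_def)
  qed
  obtain x where "x \<in> W" "x \<noteq> 0" using even_central_vector[OF assms] by (auto simp: W_def)
  from eigenvector_exists[OF vector_space_axioms sub S(1) S' lin inv this]
  show ?thesis by (auto simp: W_def)
qed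

text \<open>A square root \<open>l\<close> of the eigenvalue is the \<open>\<lambda>\<close> of the extension: with \<open>u1 = \<Delta> u0 / l\<close>, the map \<open>\<Delta>\<close>
  exchanges \<open>u0\<close> and \<open>u1\<close> up to the factor \<open>l\<close>. The eigenvalue is non-zero because \<open>\<Delta>\<close> is injective.\<close>

lemma double_extension_frame_exists:
  assumes "scenter G \<inter> \<aa> \<noteq> {0}"
  shows "\<exists>u0 u1 e0 e1 l. double_extension_frame s p G \<aa> \<bb> B \<omega> \<Delta> u0 u1 e0 e1 l"
proof -
  obtain \<mu> u0 where u0: "u0 \<in> \<aa>" "u0 \<in> part G 0" "u0 \<noteq> 0" "\<And>y. y \<in> V \<Longrightarrow> br u0 y = 0"
    and \<mu>: "\<Delta> (\<Delta> u0) = s \<mu> u0"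
    using central_eigenvector[OF assms] by blast
  have u0V: "u0 \<in> V" using part_V[OF u0(2)] .
  obtain l where l2: "l ^ 2 = \<mu>" using nth_root_exists[of 2 \<mu>] by auto
  have \<Delta>u0: "\<Delta> u0 \<noteq> 0" using \<Delta>_inj[OF u0V] u0(3) by blast
  then have "\<Delta> (\<Delta> u0) \<noteq> 0" using \<Delta>_inj[OF \<Delta>_V[OF u0V]] by blast
  then have l: "l \<noteq> 0" using l2 \<mu> by auto
  define u1 where "u1 = s (1 / l) (\<Delta> u0)"
  have 0: "\<Delta> u0 = s l u1" using l by (simp add: u1_def)
  have "\<Delta> u1 = s (1 / l) (s \<mu> u0)" using u0V \<mu> by (simp add: u1_def \<Delta>_lin)
  also have "\<dots> = s l u0" using l l2 by (simp add: power2_eq_square[symmetric] field_simps)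
  finally have 1: "\<Delta> u1 = s l u0" .
  have "\<Delta> u0 \<in> part G 1" using \<Delta>_part[OF u0(2)] by simp
  then have u1: "u1 \<in> part G 1" unfolding u1_def using subspace_scale[OF subspace_part] by blast
  have "\<Delta> u0 \<in> \<aa>" using u0(1) \<Delta>_\<aa> by blast
  then have u1\<aa>: "u1 \<in> \<aa>" unfolding u1_def using subspace_scale[OF subspace_\<aa>] by blast
  have "u1 \<noteq> 0" using \<Delta>u0 0 by auto
  have c1: "br u1 y = 0" if "y \<in> V" for y
    using \<Delta>_central[OF u0(2,4) that] br_lin(3)[OF \<Delta>_V[OF u0V] that] by (simp add: u1_def)
  obtain w0 where w0: "w0 \<in> \<bb>" "w0 \<in> part G (p + 0)" "B u0 w0 = 1"
    using dual_vector[OF u0(1-3)] by blast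
  obtain w1 where w1: "w1 \<in> \<bb>" "w1 \<in> part G (p + 1)" "B u1 w1 = 1"
    using dual_vector[OF u1\<aa> u1 \<open>u1 \<noteq> 0\<close>] by blast
  define e0 e1 where "e0 = (if p = 0 then w0 else w1)" and "e1 = (if p = 0 then w1 else w0)"
  have "p = 0 \<or> p = 1" using bit_not_zero_iff by blast
  then have e: "e0 \<in> \<bb>" "e0 \<in> part G 0" "e1 \<in> \<bb>" "e1 \<in> part G 1"
    using w0(1,2) w1(1,2) by (auto simp: e0_def e1_def)
  have d: "B u0 (if p = 0 then e0 else e1) = 1" "B u1 (if p = 0 then e1 else e0) = 1"
    using w0(3) w1(3) by (simp_all add: e0_def e1_def)
  have "double_extension_frame s p G \<aa> \<bb> B \<omega> \<Delta> u0 u1 e0 e1 l"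
    by unfold_locales (fact u0 u1\<aa> u1 c1 0 1 l e d)+
  then show ?thesis by blast
qed

lemma double_extension_of_center:
  assumes "scenter G \<inter> \<aa> \<noteq> {0}"
  shows "\<exists>H \<aa>' \<bb>' B\<^sub>H \<omega>\<^sub>H. special_manin s p H \<aa>' \<bb>' B\<^sub>H \<omega>\<^sub>H \<and>
    (if p = 0 then is_generalized_double_extension s G B \<omega> H B\<^sub>H \<omega>\<^sub>H
     else is_generalized_odd_double_extension s G B \<omega> H B\<^sub>H \<omega>\<^sub>H)"
proof -
  obtain u0 u1 e0 e1 l where "double_extension_frame s p G \<aa> \<bb> B \<omega> \<Delta> u0 u1 e0 e1 l"
    using double_extension_frame_exists[OF assms] by blast
  from double_extension_frame.double_extension_of_H[OF this] show ?thesis by blast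
qed

end

lemma special_manin_swap:
  assumes "special_manin s p G \<aa> \<bb> B \<omega>" shows "special_manin s p G \<bb> \<aa> B \<omega>"
proof -
  have sum: "{x + y | x y. x \<in> \<bb> \<and> y \<in> \<aa>} = {x + y | x y. x \<in> \<aa> \<and> y \<in> \<bb>}"
    by (auto simp: add.commute) (metis add.commute)+
  show ?thesis using assms unfolding special_manin_def Int_commute[of \<bb> \<aa>] sum
    by (elim conjE, intro conjI)
qed

theorem proposition6p6:
  fixes s :: "'k::{alg_closed_field, field_char_0} \<Rightarrow> 'v::ab_group_add \<Rightarrow> 'v"
    and p :: bit
    and G :: "'v superalgebra"
    and \<aa> \<bb> :: "'v set"
    and B \<omega> :: "'v \<Rightarrow> 'v \<Rightarrow> 'k"
    and \<Delta> :: "'v \<Rightarrow> 'v"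
  assumes "vector_space s"
    and "special_manin s p G \<aa> \<bb> B \<omega>"
    and "symplectic_derivation s G B \<omega> \<Delta>" and "\<Delta> ` \<aa> \<subseteq> \<aa>" and "\<Delta> ` \<bb> \<subseteq> \<bb>"
    and "scenter G \<inter> \<aa> \<noteq> {0} \<or> scenter G \<inter> \<bb> \<noteq> {0}"
  shows "\<exists>H \<aa>' \<bb>' B\<^sub>H \<omega>\<^sub>H. special_manin s p H \<aa>' \<bb>' B\<^sub>H \<omega>\<^sub>H \<and>
    (if p = 0 then is_generalized_double_extension s G B \<omega> H B\<^sub>H \<omega>\<^sub>H
     else is_generalized_odd_double_extension s G B \<omega> H B\<^sub>H \<omega>\<^sub>H)"
proof -
  have ab: "symplectic_manin s p G \<aa> \<bb> B \<omega> \<Delta>"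
    using assms(1-5) by (intro symplectic_manin.intro symplectic_manin_axioms.intro)
  have ba: "symplectic_manin s p G \<bb> \<aa> B \<omega> \<Delta>"
    using assms(1) special_manin_swap[OF assms(2)] assms(3-5)
    by (intro symplectic_manin.intro symplectic_manin_axioms.intro)
  show ?thesis
    using assms(6) symplectic_manin.double_extension_of_center[OF ab]
      symplectic_manin.double_extension_of_center[OF ba] by (elim disjE)
qed

end
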